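(* Let $\mathcal{M}$ be a simple matroid, let $\mathfrak{g}$ be a finite-dimensional complex Lie algebra, and let $K$ be a finite set with at least $3$ elements. For every $\tau\in Z'_K(\mathcal{M})\setminus B_K(\mathcal{M})$, the map $\mathrm{ev}_\tau\colon\mathfrak{g}^K\to\mathfrak{g}^{\mathcal{M}}$, $\mathrm{ev}_\tau(x)_u=x_{\tau(u)}$ for $u\in\mathcal{M}$, induces a linear embedding $$\mathrm{ev}_\tau\colon\mathcal{H}^K(\mathfrak{g})\hookrightarrow\mathcal{F}(A(\mathcal{M})\otimes\mathbb{C},\mathfrak{g}).$$ Moreover, $\mathrm{ev}_\tau$ is rank-preserving, and so the regular parts are preserved.
   Context: A matroid is simple if all subsets of size at most two are independent; $L_2(\mathcal{M})$ is the set of rank-$2$ flats. $B_K(\mathcal{M})\subseteq K^{\mathcal{M}}$ is the set of constant functions; $Z'_K(\mathcal{M})$ is the set of functions $\tau\colon\mathcal{M}\to K$ whose restriction to each $X\in L_2(\mathcal{M})$ is either constant or bijective. $A(\mathcal{M})=E/(\partial e_S : S\text{ a circuit})$ is the Orlik–Solomon algebra, with $E$ the exterior algebra over $\mathbb{Z}$ on degree-one generators $e_u$, $u\in\mathcal{M}$, $\partial$ the graded derivation of degree $-1$ with $\partial e_u=1$, $e_S=\prod_{u\in S}e_u$. With $A=A(\mathcal{M})\otimes\mathbb{C}$ (zero differential), $A\otimes\mathfrak{g}$ has bracket $[a\otimes x,b\otimes y]=ab\otimes[x,y]$, and $\mathcal{F}(A,\mathfrak{g})=\{\omega\in A^1\otimes\mathfrak{g}\mid[\omega,\omega]=0\}$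 is the set of $\mathfrak{g}$-valued flat connections. Identify $A^1\otimes\mathfrak{g}=\mathfrak{g}^{\mathcal{M}}$ via $\omega=\sum_u e_u\otimes\omega_u$; then $\omega\in\mathcal{F}(A,\mathfrak{g})$ iff $\sum_{v\in X}[\omega_u,\omega_v]=0$ for all $X\in L_2(\mathcal{M})$, $u\in X$. $\mathcal{H}^K(\mathfrak{g})=\{x=(x_\alpha)\in\mathfrak{g}^K\mid\sum_{\alpha\in K}x_\alpha=0\}$. The rank of a family of vectors is the dimension of its span; "rank-preserving" means that the families $(x_\alpha)_{\alpha\in K}$ and $(\mathrm{ev}_\tau(x)_u)_{u\in\mathcal{M}}$ have the same rank. The regular part of $\mathcal{H}^K(\mathfrak{g})$, respectively of $\mathcal{F}(A,\mathfrak{g})$, is the subset of elements whose family of components has rank at least $2$. *)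

theory Defs
  imports
    Complex_Main
    "HOL-Library.FuncSet"
    "HOL-Algebra.Free_Abelian_Groups"
    "HOL-Algebra.IntRing"
    "HOL-Algebra.Module"
    "HOL-Algebra.QuotRing"
    "HOL-Algebra.Generated_Groups"
begin

section \<open>Matroids\<close>

locale matroid =
  fixes M :: "'m set" and indep :: "'m set \<Rightarrow> bool"
  assumes finite_ground: "finite M"
    and indep_ground: "indep I \<Longrightarrow> I \<subseteq> M"
    and indep_empty: "indep {}"
    and indep_subset: "indep I \<Longrightarrow> J \<subseteq> I \<Longrightarrow> indep J"
    and indep_augment: "indep I \<Longrightarrow> indep J \<Longrightarrow> card I < card J \<Longrightarrow>
      \<exists>u \<in> J - I. indep (insert u I)"

definition simple_matroid :: "'m set \<Rightarrow> ('m set \<Rightarrow> bool) \<Rightarrow> bool" where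
  "simple_matroid M indep \<longleftrightarrow> matroid M indep \<and> (\<forall>S \<subseteq> M. card S \<le> 2 \<longrightarrow> indep S)"

definition matroid_rank :: "('m set \<Rightarrow> bool) \<Rightarrow> 'm set \<Rightarrow> nat" where
  "matroid_rank indep S = Max (card ` {I. I \<subseteq> S \<and> indep I})"

definition flat :: "'m set \<Rightarrow> ('m set \<Rightarrow> bool) \<Rightarrow> 'm set \<Rightarrow> bool" where
  "flat M indep X \<longleftrightarrow> X \<subseteq> M \<and>
     (\<forall>u \<in> M - X. matroid_rank indep X < matroid_rank indep (insert u X))"

definition rank2_flats :: "'m set \<Rightarrow> ('m set \<Rightarrow> bool) \<Rightarrow> 'm set set" where
  "rank2_flats M indep = {X. flat M indep X \<and> matroid_rank indep X = 2}"

definition circuit :: "'m set \<Rightarrow> ('m set \<Rightarrow> bool) \<Rightarrow> 'm set \<Rightarrow> bool" where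
  "circuit M indep S \<longleftrightarrow> S \<subseteq> M \<and> \<not> indep S \<and> (\<forall>T. T \<subset> S \<longrightarrow> indep T)"

definition const_funs :: "'m set \<Rightarrow> 'k set \<Rightarrow> ('m \<Rightarrow> 'k) set" where
  "const_funs M K = {\<tau> \<in> M \<rightarrow>\<^sub>E K. \<exists>k \<in> K. \<forall>u \<in> M. \<tau> u = k}"

definition special_funs :: "'m set \<Rightarrow> ('m set \<Rightarrow> bool) \<Rightarrow> 'k set \<Rightarrow> ('m \<Rightarrow> 'k) set" where
  "special_funs M indep K =
     {\<tau> \<in> M \<rightarrow>\<^sub>E K. \<forall>X \<in> rank2_flats M indep.
        (\<exists>k \<in> K. \<forall>u \<in> X. \<tau> u = k) \<or> bij_betw \<tau> X K}"

section \<open>The Orlik--Solomon algebra\<close>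

text \<open>
  The free associative ring on \<open>M\<close>, i.e. the tensor algebra of the free abelian group on \<open>M\<close>:
  finitely supported integer combinations of words over \<open>M\<close>, multiplied by concatenation.
\<close>

definition free_ring :: "'m set \<Rightarrow> ('m list \<Rightarrow>\<^sub>0 int) ring" where
  "free_ring M =
     \<lparr>carrier = {x. Poly_Mapping.keys x \<subseteq> lists M},
      monoid.mult = (\<lambda>x y. frag_extend (\<lambda>v. frag_extend (\<lambda>w. frag_of (v @ w)) y) x),
      one = frag_of [],
      ring.zero = 0,
      add = (+)\<rparr>"

definition free_ring_degree_one :: "'m set \<Rightarrow> ('m list \<Rightarrow>\<^sub>0 int) set" where
  "free_ring_degree_one M =
     {x \<in> carrier (free_ring M). \<forall>w \<in> Poly_Mapping.keys x. length w = 1}"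

definition exterior_ideal :: "'m set \<Rightarrow> ('m list \<Rightarrow>\<^sub>0 int) set" where
  "exterior_ideal M =
     Idl\<^bsub>free_ring M\<^esub> {v \<otimes>\<^bsub>free_ring M\<^esub> v |v. v \<in> free_ring_degree_one M}"

definition exterior_algebra :: "'m set \<Rightarrow> ('m list \<Rightarrow>\<^sub>0 int) set ring" where
  "exterior_algebra M = free_ring M Quot exterior_ideal M"

definition ext_gen :: "'m set \<Rightarrow> 'm \<Rightarrow> ('m list \<Rightarrow>\<^sub>0 int) set" where
  "ext_gen M u = exterior_ideal M +>\<^bsub>free_ring M\<^esub> frag_of [u]"

definition ext_prod :: "'m set \<Rightarrow> 'm list \<Rightarrow> ('m list \<Rightarrow>\<^sub>0 int) set" where
  "ext_prod M us =
     foldr (\<lambda>u y. ext_gen M u \<otimes>\<^bsub>exterior_algebra M\<^esub> y) us \<one>\<^bsub>exterior_algebra M\<^esub>"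

text \<open>
  The graded derivation of degree \<open>-1\<close> of the free ring that sends every generator to \<open>1\<close>.
  It maps the exterior ideal into itself, so it induces the derivation on the exterior algebra;
  as for the operations of \<^const>\<open>FactRing\<close>, the induced map is written as a union over all
  representatives of a coset.
\<close>

definition free_deriv :: "('m list \<Rightarrow>\<^sub>0 int) \<Rightarrow> 'm list \<Rightarrow>\<^sub>0 int" where
  "free_deriv =
     frag_extend (\<lambda>w. \<Sum>i<length w. frag_cmul ((-1) ^ i) (frag_of (take i w @ drop (Suc i) w)))"

definition ext_deriv :: "'m set \<Rightarrow> ('m list \<Rightarrow>\<^sub>0 int) set \<Rightarrow> ('m list \<Rightarrow>\<^sub>0 int) set" where
  "ext_deriv M X = (\<Union>x \<in> X. exterior_ideal M +>\<^bsub>free_ring M\<^esub> free_deriv x)"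

text \<open>
  For a circuit \<open>S\<close> the monomial \<open>e\<^sub>S\<close> depends, up to sign, on an enumeration of \<open>S\<close>.
  All enumerations are used, which does not change the ideal and avoids ordering \<open>M\<close>.
\<close>

definition os_ideal :: "'m set \<Rightarrow> ('m set \<Rightarrow> bool) \<Rightarrow> ('m list \<Rightarrow>\<^sub>0 int) set set" where
  "os_ideal M indep =
     Idl\<^bsub>exterior_algebra M\<^esub>
       {ext_deriv M (ext_prod M us) |us. distinct us \<and> circuit M indep (set us)}"

definition orlik_solomon :: "'m set \<Rightarrow> ('m set \<Rightarrow> bool) \<Rightarrow> ('m list \<Rightarrow>\<^sub>0 int) set set ring" where
  "orlik_solomon M indep = exterior_algebra M Quot os_ideal M indep"

definition os_class ::
  "'m set \<Rightarrow> ('m set \<Rightarrow> bool) \<Rightarrow> ('m list \<Rightarrow>\<^sub>0 int) \<Rightarrow> ('m list \<Rightarrow>\<^sub>0 int) set set" where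
  "os_class M indep x =
     os_ideal M indep +>\<^bsub>exterior_algebra M\<^esub> (exterior_ideal M +>\<^bsub>free_ring M\<^esub> x)"

definition os_degree_one :: "'m set \<Rightarrow> ('m set \<Rightarrow> bool) \<Rightarrow> ('m list \<Rightarrow>\<^sub>0 int) set set set" where
  "os_degree_one M indep = os_class M indep ` free_ring_degree_one M"

section \<open>Tensor products\<close>

text \<open>
  The tensor product of two modules \<open>P\<close>, \<open>Q\<close> over a commutative ring \<open>R\<close>: the free abelian group
  on pairs, modulo the bilinearity and balancing relations. If \<open>P\<close> and \<open>Q\<close> carry bilinear (not
  necessarily associative or unital) products, so does the tensor product, via
  \<open>(p \<otimes> q) (p' \<otimes> q') = p p' \<otimes> q q'\<close>.
\<close>

definition tensor_rels ::
  "('r, 'x) ring_scheme \<Rightarrow> ('r, 'p, 'y) module_scheme \<Rightarrow> ('r, 'q, 'z) module_scheme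
     \<Rightarrow> ('p \<times> 'q \<Rightarrow>\<^sub>0 int) set" where
  "tensor_rels R P Q =
     {frag_of (p \<oplus>\<^bsub>P\<^esub> p', q) - frag_of (p, q) - frag_of (p', q) |p p' q.
        p \<in> carrier P \<and> p' \<in> carrier P \<and> q \<in> carrier Q} \<union>
     {frag_of (p, q \<oplus>\<^bsub>Q\<^esub> q') - frag_of (p, q) - frag_of (p, q') |p q q'.
        p \<in> carrier P \<and> q \<in> carrier Q \<and> q' \<in> carrier Q} \<union>
     {frag_of (r \<odot>\<^bsub>P\<^esub> p, q) - frag_of (p, r \<odot>\<^bsub>Q\<^esub> q) |r p q.
        r \<in> carrier R \<and> p \<in> carrier P \<and> q \<in> carrier Q}"

definition tensor_subgroup ::
  "('r, 'x) ring_scheme \<Rightarrow> ('r, 'p, 'y) module_scheme \<Rightarrow> ('r, 'q, 'z) module_scheme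
     \<Rightarrow> ('p \<times> 'q \<Rightarrow>\<^sub>0 int) set" where
  "tensor_subgroup R P Q =
     generate (free_Abelian_group (carrier P \<times> carrier Q)) (tensor_rels R P Q)"

definition tensor_class ::
  "('r, 'x) ring_scheme \<Rightarrow> ('r, 'p, 'y) module_scheme \<Rightarrow> ('r, 'q, 'z) module_scheme
     \<Rightarrow> ('p \<times> 'q \<Rightarrow>\<^sub>0 int) \<Rightarrow> ('p \<times> 'q \<Rightarrow>\<^sub>0 int) set" where
  "tensor_class R P Q x =
     tensor_subgroup R P Q #>\<^bsub>free_Abelian_group (carrier P \<times> carrier Q)\<^esub> x"

definition pure_tensor ::
  "('r, 'x) ring_scheme \<Rightarrow> ('r, 'p, 'y) module_scheme \<Rightarrow> ('r, 'q, 'z) module_scheme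
     \<Rightarrow> 'p \<Rightarrow> 'q \<Rightarrow> ('p \<times> 'q \<Rightarrow>\<^sub>0 int) set" where
  "pure_tensor R P Q p q = tensor_class R P Q (frag_of (p, q))"

definition tensor_product ::
  "('r, 'x) ring_scheme \<Rightarrow> ('r, 'p, 'y) module_scheme \<Rightarrow> ('r, 'q, 'z) module_scheme
     \<Rightarrow> ('r, ('p \<times> 'q \<Rightarrow>\<^sub>0 int) set) module" where
  "tensor_product R P Q =
     (let G = free_Abelian_group (carrier P \<times> carrier Q) Mod tensor_subgroup R P Q in
     \<lparr>carrier = carrier G,
      monoid.mult = (\<lambda>X Y. \<Union>x \<in> X. \<Union>y \<in> Y. tensor_class R P Q
        (frag_extend (\<lambda>(p, q). frag_extend
           (\<lambda>(p', q'). frag_of (p \<otimes>\<^bsub>P\<^esub> p', q \<otimes>\<^bsub>Q\<^esub> q')) y) x)),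
      one = pure_tensor R P Q \<one>\<^bsub>P\<^esub> \<one>\<^bsub>Q\<^esub>,
      ring.zero = \<one>\<^bsub>G\<^esub>,
      add = (\<lambda>X Y. X \<otimes>\<^bsub>G\<^esub> Y),
      smult = (\<lambda>r X. \<Union>x \<in> X. tensor_class R P Q
        (frag_extend (\<lambda>(p, q). frag_of (r \<odot>\<^bsub>P\<^esub> p, q)) x))\<rparr>)"

definition int_module :: "('a, 'x) ring_scheme \<Rightarrow> (int, 'a) module" where
  "int_module A =
     \<lparr>carrier = carrier A, monoid.mult = monoid.mult A, one = one A,
      ring.zero = ring.zero A, add = add A, smult = (\<lambda>k a. [k] \<cdot>\<^bsub>A\<^esub> a)\<rparr>"

abbreviation complex_ring :: "complex ring" where
  "complex_ring \<equiv> \<lparr>carrier = UNIV, monoid.mult = (*), one = 1, ring.zero = 0, add = (+)\<rparr>"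

text \<open>The \<open>\<complex>\<close>-algebra \<open>A \<otimes>\<^sub>\<int> \<complex>\<close>, where \<open>z\<close> acts as multiplication by \<open>1 \<otimes> z\<close>.\<close>

definition complex_tensor :: "('a, 'x) ring_scheme \<Rightarrow> 'a \<Rightarrow> complex \<Rightarrow> ('a \<times> complex \<Rightarrow>\<^sub>0 int) set" where
  "complex_tensor A = pure_tensor \<Z> (int_module A) (int_module complex_ring)"

definition complexification ::
  "('a, 'x) ring_scheme \<Rightarrow> (complex, ('a \<times> complex \<Rightarrow>\<^sub>0 int) set) module" where
  "complexification A =
     (let T = tensor_product \<Z> (int_module A) (int_module complex_ring) in
     \<lparr>carrier = carrier T, monoid.mult = monoid.mult T, one = one T,
      ring.zero = ring.zero T, add = add T,
      smult = (\<lambda>z X. complex_tensor A \<one>\<^bsub>A\<^esub> z \<otimes>\<^bsub>T\<^esub> X)\<rparr>)"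

section \<open>Flat connections\<close>

locale lie_algebra = vector_space scale
  for scale :: "'f::field \<Rightarrow> 'g::ab_group_add \<Rightarrow> 'g" +
  fixes bracket :: "'g \<Rightarrow> 'g \<Rightarrow> 'g"
  assumes bracket_add_left: "bracket (x + y) z = bracket x z + bracket y z"
    and bracket_add_right: "bracket x (y + z) = bracket x y + bracket x z"
    and bracket_scale_left: "bracket (scale c x) y = scale c (bracket x y)"
    and bracket_scale_right: "bracket x (scale c y) = scale c (bracket x y)"
    and bracket_self: "bracket x x = 0"
    and jacobi: "bracket x (bracket y z) + bracket y (bracket z x) + bracket z (bracket x y) = 0"

text \<open>A Lie algebra as a module record whose product is the bracket; its unit entry is a dummy value.\<close>

definition lie_module ::
  "(complex \<Rightarrow> 'g::ab_group_add \<Rightarrow> 'g) \<Rightarrow> ('g \<Rightarrow> 'g \<Rightarrow> 'g) \<Rightarrow> (complex, 'g) module" where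
  "lie_module scale bracket =
     \<lparr>carrier = UNIV, monoid.mult = bracket, one = 0, ring.zero = 0, add = (+), smult = scale\<rparr>"

type_synonym ('m, 'g) os_lie =
  "((('m list \<Rightarrow>\<^sub>0 int) set set \<times> complex \<Rightarrow>\<^sub>0 int) set \<times> 'g \<Rightarrow>\<^sub>0 int) set"

text \<open>
  \<open>(A(M) \<otimes> \<complex>) \<otimes>\<^sub>\<complex> \<gg>\<close>; its product is the bracket
  \<open>[a \<otimes> x, b \<otimes> y] = a b \<otimes> [x, y]\<close>.
\<close>

definition os_lie ::
  "'m set \<Rightarrow> ('m set \<Rightarrow> bool) \<Rightarrow> (complex \<Rightarrow> 'g::ab_group_add \<Rightarrow> 'g) \<Rightarrow> ('g \<Rightarrow> 'g \<Rightarrow> 'g)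
     \<Rightarrow> (complex, ('m, 'g) os_lie) module" where
  "os_lie M indep scale bracket =
     tensor_product complex_ring (complexification (orlik_solomon M indep))
       (lie_module scale bracket)"

definition os_lie_tensor ::
  "'m set \<Rightarrow> ('m set \<Rightarrow> bool) \<Rightarrow> (complex \<Rightarrow> 'g::ab_group_add \<Rightarrow> 'g) \<Rightarrow> ('g \<Rightarrow> 'g \<Rightarrow> 'g)
     \<Rightarrow> ('m list \<Rightarrow>\<^sub>0 int) set set \<Rightarrow> complex \<Rightarrow> 'g \<Rightarrow> ('m, 'g) os_lie" where
  "os_lie_tensor M indep scale bracket a z x =
     pure_tensor complex_ring (complexification (orlik_solomon M indep))
       (lie_module scale bracket) (complex_tensor (orlik_solomon M indep) a z) x"

definition os_lie_degree_one ::
  "'m set \<Rightarrow> ('m set \<Rightarrow> bool) \<Rightarrow> (complex \<Rightarrow> 'g::ab_group_add \<Rightarrow> 'g) \<Rightarrow> ('g \<Rightarrow> 'g \<Rightarrow> 'g)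
     \<Rightarrow> ('m, 'g) os_lie set" where
  "os_lie_degree_one M indep scale bracket =
     generate (add_monoid (os_lie M indep scale bracket))
       {os_lie_tensor M indep scale bracket a z x |a z x. a \<in> os_degree_one M indep}"

definition flat_connections ::
  "'m set \<Rightarrow> ('m set \<Rightarrow> bool) \<Rightarrow> (complex \<Rightarrow> 'g::ab_group_add \<Rightarrow> 'g) \<Rightarrow> ('g \<Rightarrow> 'g \<Rightarrow> 'g)
     \<Rightarrow> ('m, 'g) os_lie set" where
  "flat_connections M indep scale bracket =
     {\<omega> \<in> os_lie_degree_one M indep scale bracket.
        \<omega> \<otimes>\<^bsub>os_lie M indep scale bracket\<^esub> \<omega> = \<zero>\<^bsub>os_lie M indep scale bracket\<^esub>}"

text \<open>The identification of \<open>\<gg>\<^sup>M\<close> with \<open>A\<^sup>1 \<otimes> \<gg>\<close>, sending \<open>c\<close> to \<open>\<Sum>\<^sub>u e\<^sub>u \<otimes> c\<^sub>u\<close>.\<close>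

definition connection ::
  "'m set \<Rightarrow> ('m set \<Rightarrow> bool) \<Rightarrow> (complex \<Rightarrow> 'g::ab_group_add \<Rightarrow> 'g) \<Rightarrow> ('g \<Rightarrow> 'g \<Rightarrow> 'g)
     \<Rightarrow> ('m \<Rightarrow> 'g) \<Rightarrow> ('m, 'g) os_lie" where
  "connection M indep scale bracket c =
     (\<Oplus>\<^bsub>os_lie M indep scale bracket\<^esub>u \<in> M.
        os_lie_tensor M indep scale bracket (os_class M indep (frag_of [u])) 1 (c u))"

section \<open>Evaluation maps\<close>

definition sum_zero :: "'k set \<Rightarrow> ('k \<Rightarrow> 'g::ab_group_add) set" where
  "sum_zero K = {x \<in> K \<rightarrow>\<^sub>E UNIV. (\<Sum>\<alpha>\<in>K. x \<alpha>) = 0}"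

definition eval_map :: "'m set \<Rightarrow> ('m \<Rightarrow> 'k) \<Rightarrow> ('k \<Rightarrow> 'g) \<Rightarrow> 'm \<Rightarrow> 'g" where
  "eval_map M \<tau> x = (\<lambda>u\<in>M. x (\<tau> u))"

definition family_rank ::
  "(complex \<Rightarrow> 'g::ab_group_add \<Rightarrow> 'g) \<Rightarrow> 'i set \<Rightarrow> ('i \<Rightarrow> 'g) \<Rightarrow> nat" where
  "family_rank scale I x = vector_space.dim scale (module.span scale (x ` I))"

definition regular_sum_zero ::
  "(complex \<Rightarrow> 'g::ab_group_add \<Rightarrow> 'g) \<Rightarrow> 'k set \<Rightarrow> ('k \<Rightarrow> 'g) set" where
  "regular_sum_zero scale K = {x \<in> sum_zero K. 2 \<le> family_rank scale K x}"

definition regular_flat_connections ::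
  "'m set \<Rightarrow> ('m set \<Rightarrow> bool) \<Rightarrow> (complex \<Rightarrow> 'g::ab_group_add \<Rightarrow> 'g) \<Rightarrow> ('g \<Rightarrow> 'g \<Rightarrow> 'g)
     \<Rightarrow> ('m, 'g) os_lie set" where
  "regular_flat_connections M indep scale bracket =
     {\<omega> \<in> flat_connections M indep scale bracket.
        \<exists>c \<in> M \<rightarrow>\<^sub>E UNIV. \<omega> = connection M indep scale bracket c \<and> 2 \<le> family_rank scale M c}"

end

(*
  Two elements u, v of a simple matroid lie on exactly one rank-2 flat, and any three elements of
  such a flat X are dependent, so e_u e_v = (e_u - e_v) e_w in the Orlik-Solomon algebra for
  u, v, w in X. Splitting the square of sum_u e_u (x) c_u along rank-2 flats and fixing w in each X
  expresses it through the sums sum_{v in X} [c_u, c_v]; it vanishes when all of these do. For c = ev_tau(x)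
  such a sum is [x_k, x_k] up to a factor if tau is constant on X, and [x_{tau u}, sum_k x_k] if tau
  is bijective on X. A non-constant tau is bijective on some X, hence onto K, so ev_tau only repeats
  components. Injectivity holds because the defining relations have degree at least two, so that
  the coefficient of e_u is well defined on the quotient.
*)
theory Submission
  imports Defs
begin

text \<open>No basis of the Orlik-Solomon algebra is constructed. The target \<open>V\<close> comes
  from four quotient constructions: the exterior algebra, the circuit relations, the tensor product
  with the complex numbers and the tensor product with the Lie algebra. That an element vanishes is
  shown on representatives, where an equation between tensors becomes membership in the subgroup of
  relations. That two connections differ needs a functional that survives every quotient. It is
  built in stages, with integer, then complex, then vector values; each stage evaluates an arbitrary
  representative and is well defined because it kills the relations of that stage. The circuit
  relations are derivatives taken inside a quotient, so the derivation must first be shown to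
  preserve the exterior ideal. Simplicity is used through small independent sets: a dependent triple
  is a circuit, and two distinct elements have rank two and hence span a rank-2 flat.\<close>

section \<open>Bilinear products of finitely supported functions\<close>

text \<open>The products of \<open>free_ring\<close> (\<open>m\<close> concatenates words) and of
  \<open>tensor_product\<close> (\<open>m\<close> multiplies pairs componentwise) both have this
  shape, so one bi-additive calculus serves both.\<close>

definition frag_mult :: "('a \<Rightarrow> 'b \<Rightarrow> 'c) \<Rightarrow> ('a \<Rightarrow>\<^sub>0 int) \<Rightarrow> ('b \<Rightarrow>\<^sub>0 int) \<Rightarrow> 'c \<Rightarrow>\<^sub>0 int" where
  "frag_mult m x y = frag_extend (\<lambda>a. frag_extend (\<lambda>b. frag_of (m a b)) y) x"

lemma frag_extend_add_fun:
  "frag_extend (\<lambda>a. f a + g a) x = frag_extend f x + frag_extend g x"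
  by (simp add: frag_extend_def frag_cmul_distrib2 sum.distrib)

lemma frag_extend_minus_fun: "frag_extend (\<lambda>a. - f a) x = - frag_extend f x"
  using frag_extend_add_fun[of f "\<lambda>a. - f a" x] by (simp add: frag_extend_eq_0 eq_neg_iff_add_eq_0 add.commute)

lemma frag_extend_diff_fun:
  "frag_extend (\<lambda>a. f a - g a) x = frag_extend f x - frag_extend g x"
  using frag_extend_add_fun[of f "\<lambda>a. - g a" x] by (simp add: frag_extend_minus_fun)

lemma frag_mult_of [simp]: "frag_mult m (frag_of a) (frag_of b) = frag_of (m a b)"
  by (simp add: frag_mult_def)

lemma frag_mult_zero_left [simp]: "frag_mult m 0 y = 0"
  by (simp add: frag_mult_def)

lemma frag_mult_zero_right [simp]: "frag_mult m x 0 = 0"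
  by (simp add: frag_mult_def frag_extend_eq_0)

lemma frag_mult_add_left: "frag_mult m (x + x') y = frag_mult m x y + frag_mult m x' y"
  by (simp add: frag_mult_def frag_extend_add)

lemma frag_mult_add_right: "frag_mult m x (y + y') = frag_mult m x y + frag_mult m x y'"
  by (simp add: frag_mult_def frag_extend_add frag_extend_add_fun)

lemma frag_mult_minus_left: "frag_mult m (- x) y = - frag_mult m x y"
  by (simp add: frag_mult_def frag_extend_minus)

lemma frag_mult_minus_right: "frag_mult m x (- y) = - frag_mult m x y"
  by (simp add: frag_mult_def frag_extend_minus frag_extend_minus_fun)

lemma frag_mult_diff_left: "frag_mult m (x - x') y = frag_mult m x y - frag_mult m x' y"
  by (simp add: frag_mult_def frag_extend_diff)

lemma frag_mult_diff_right: "frag_mult m x (y - y') = frag_mult m x y - frag_mult m x y'"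
  by (simp add: frag_mult_def frag_extend_diff frag_extend_diff_fun)

lemma frag_mult_sum_left: "finite I \<Longrightarrow> frag_mult m (sum f I) y = (\<Sum>i\<in>I. frag_mult m (f i) y)"
  by (induction rule: finite_induct) (simp_all add: frag_mult_add_left)

lemma frag_mult_sum_right: "finite I \<Longrightarrow> frag_mult m x (sum f I) = (\<Sum>i\<in>I. frag_mult m x (f i))"
  by (induction rule: finite_induct) (simp_all add: frag_mult_add_right)

lemma keys_frag_mult:
  "Poly_Mapping.keys (frag_mult m x y) \<subseteq> {m a b |a b. a \<in> Poly_Mapping.keys x \<and> b \<in> Poly_Mapping.keys y}"
  unfolding frag_mult_def
  by (rule order_trans[OF keys_frag_extend]) (use keys_frag_extend in fastforce)

text \<open>Both arguments are finite integer combinations, so a property closed under differences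
  in each argument only has to be checked on generators. The support sets \<open>S\<close> and
  \<open>T\<close> survive into the generator case, where they provide membership in a
  carrier.\<close>

lemma frag_mult_induct [consumes 2, case_names one zero_left zero_right diff_left diff_right]:
  assumes "Poly_Mapping.keys x \<subseteq> S" "Poly_Mapping.keys y \<subseteq> T"
    and "\<And>a b. a \<in> S \<Longrightarrow> b \<in> T \<Longrightarrow> P (frag_of a) (frag_of b)"
    and "\<And>y. P 0 y" "\<And>x. P x 0"
    and "\<And>x x' y. P x y \<Longrightarrow> P x' y \<Longrightarrow> P (x - x') y"
    and "\<And>x y y'. P x y \<Longrightarrow> P x y' \<Longrightarrow> P x (y - y')"
  shows "P x y"
  using assms(1)
proof (induction rule: frag_induction)
  case (one a)
  from assms(2) show ?case
    by (induction rule: frag_induction) (use assms one in auto)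
qed (use assms in auto)

lemma frag_mult_assoc:
  assumes "Poly_Mapping.keys x \<subseteq> S" "Poly_Mapping.keys y \<subseteq> T" "Poly_Mapping.keys z \<subseteq> U"
    and "\<And>a b c. a \<in> S \<Longrightarrow> b \<in> T \<Longrightarrow> c \<in> U \<Longrightarrow> m (m a b) c = m a (m b c)"
  shows "frag_mult m (frag_mult m x y) z = frag_mult m x (frag_mult m y z)"
proof -
  have *: "frag_mult m (frag_mult m x y) (frag_of c) = frag_mult m x (frag_mult m y (frag_of c))"
    if "c \<in> U" for c
    using assms(1,2)
    by (induction rule: frag_mult_induct)
      (auto simp: frag_mult_diff_left frag_mult_diff_right assms(4) that)
  from assms(3) show ?thesis
    by (induction rule: frag_induction) (auto simp: frag_mult_diff_right *)
qed

lemma keys_add_subset: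
  "Poly_Mapping.keys x \<subseteq> S \<Longrightarrow> Poly_Mapping.keys y \<subseteq> S \<Longrightarrow> Poly_Mapping.keys (x + y) \<subseteq> S"
  using keys_add[of x y] by (meson Un_least order_trans)

lemma keys_diff_subset:
  "Poly_Mapping.keys x \<subseteq> S \<Longrightarrow> Poly_Mapping.keys y \<subseteq> S \<Longrightarrow> Poly_Mapping.keys (x - y) \<subseteq> S"
  using keys_diff[of x y] by (meson Un_least order_trans)

section \<open>The free ring and the exterior algebra\<close>

lemma free_ring_simps:
  "x \<in> carrier (free_ring M) \<longleftrightarrow> Poly_Mapping.keys x \<subseteq> lists M"
  "x \<otimes>\<^bsub>free_ring M\<^esub> y = frag_mult (@) x y"
  "\<one>\<^bsub>free_ring M\<^esub> = frag_of []"
  "\<zero>\<^bsub>free_ring M\<^esub> = 0"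
  "x \<oplus>\<^bsub>free_ring M\<^esub> y = x + y"
  by (auto simp: free_ring_def frag_mult_def)

lemma frag_mult_append_one [simp]:
  "frag_mult (@) (frag_of []) x = x" "frag_mult (@) x (frag_of []) = x"
  by (simp_all add: frag_mult_def flip: frag_expansion)

lemma append_keys:
  "Poly_Mapping.keys x \<subseteq> lists M \<Longrightarrow> Poly_Mapping.keys y \<subseteq> lists M \<Longrightarrow>
    Poly_Mapping.keys (frag_mult (@) x y) \<subseteq> lists M"
  using keys_frag_mult[of "(@)" x y] by fastforce

lemma ring_free_ring: "ring (free_ring M)"
proof (rule ringI)
  show "abelian_group (free_ring M)"
  proof (rule abelian_groupI)
    fix x assume x: "x \<in> carrier (free_ring M)"
    show "\<exists>y\<in>carrier (free_ring M). y \<oplus>\<^bsub>free_ring M\<^esub> x = \<zero>\<^bsub>free_ring M\<^esub>"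
      by (rule bexI[of _ "- x"]) (use x in \<open>auto simp: free_ring_simps\<close>)
  qed (simp_all add: free_ring_simps keys_add_subset add.assoc add.commute)
  show "Group.monoid (free_ring M)"
    by (rule monoidI) (simp_all add: free_ring_simps append_keys frag_mult_assoc[of _ UNIV _ UNIV _ UNIV])
qed (auto simp: free_ring_simps frag_mult_add_left frag_mult_add_right)

interpretation free: ring "free_ring M" for M
  by (rule ring_free_ring)

lemma free_ring_minus: "x \<in> carrier (free_ring M) \<Longrightarrow> \<ominus>\<^bsub>free_ring M\<^esub> x = - x"
  by (rule free.minus_equality) (auto simp: free_ring_simps)

lemma free_degree_one_carrier: "v \<in> free_ring_degree_one M \<Longrightarrow> v \<in> carrier (free_ring M)"
  by (simp add: free_ring_degree_one_def)

lemma exterior_ideal_ideal: "ideal (exterior_ideal M) (free_ring M)"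
  unfolding exterior_ideal_def
  by (rule free.genideal_ideal) (auto simp: free_degree_one_carrier)

lemma free_idealI:
  assumes "J \<subseteq> carrier (free_ring M)" "0 \<in> J" "\<And>x y. x \<in> J \<Longrightarrow> y \<in> J \<Longrightarrow> x - y \<in> J"
    and "\<And>a x. a \<in> carrier (free_ring M) \<Longrightarrow> x \<in> J \<Longrightarrow> frag_mult (@) a x \<in> J"
    and "\<And>a x. a \<in> carrier (free_ring M) \<Longrightarrow> x \<in> J \<Longrightarrow> frag_mult (@) x a \<in> J"
  shows "ideal J (free_ring M)"
proof (rule idealI[OF ring_free_ring])
  have neg: "- x \<in> J" if "x \<in> J" for x
    using assms(2) assms(3)[of 0 x] that by auto
  have add: "x + y \<in> J" if "x \<in> J" "y \<in> J" for x y
    using assms(3)[OF that(1) neg[OF that(2)]] by simp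
  show "subgroup J (add_monoid (free_ring M))"
  proof (rule group.subgroupI)
    show "group (add_monoid (free_ring M))"
      by (rule free.a_group)
    show "J \<noteq> {}" using assms(2) by blast
    fix x assume x: "x \<in> J"
    then show "inv\<^bsub>add_monoid (free_ring M)\<^esub> x \<in> J"
      using free_ring_minus[of x M] neg assms(1) unfolding a_inv_def by auto
  qed (use assms(1) add in \<open>auto simp: free_ring_simps\<close>)
qed (use assms(4,5) in \<open>auto simp: free_ring_simps(2)\<close>)

lemma exterior_ideal_closed:
  "0 \<in> exterior_ideal M"
  "x \<in> exterior_ideal M \<Longrightarrow> Poly_Mapping.keys x \<subseteq> lists M"
  "x \<in> exterior_ideal M \<Longrightarrow> y \<in> exterior_ideal M \<Longrightarrow> x + y \<in> exterior_ideal M"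
  "x \<in> exterior_ideal M \<Longrightarrow> - x \<in> exterior_ideal M"
  "x \<in> exterior_ideal M \<Longrightarrow> y \<in> exterior_ideal M \<Longrightarrow> x - y \<in> exterior_ideal M"
  "x \<in> exterior_ideal M \<Longrightarrow> Poly_Mapping.keys a \<subseteq> lists M \<Longrightarrow> frag_mult (@) a x \<in> exterior_ideal M"
  "x \<in> exterior_ideal M \<Longrightarrow> Poly_Mapping.keys a \<subseteq> lists M \<Longrightarrow> frag_mult (@) x a \<in> exterior_ideal M"
proof -
  show "0 \<in> exterior_ideal M"
    using additive_subgroup.zero_closed[OF ideal.axioms(1)[OF exterior_ideal_ideal[of M]]] by (simp add: free_ring_simps)
  show c: "x \<in> exterior_ideal M \<Longrightarrow> Poly_Mapping.keys x \<subseteq> lists M" for x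
    using ideal.Icarr[OF exterior_ideal_ideal, of x M] by (simp add: free_ring_simps)
  show add: "x \<in> exterior_ideal M \<Longrightarrow> y \<in> exterior_ideal M \<Longrightarrow> x + y \<in> exterior_ideal M" for x y
    using additive_subgroup.a_closed[OF ideal.axioms(1)[OF exterior_ideal_ideal[of M]], of x y] by (simp add: free_ring_simps)
  \<comment> \<open>Negation is multiplication by minus the empty word.\<close>
  show neg: "x \<in> exterior_ideal M \<Longrightarrow> - x \<in> exterior_ideal M" for x
    using ideal.I_l_closed[OF exterior_ideal_ideal, of x M "- frag_of []"]
    by (simp add: free_ring_simps frag_mult_minus_left)
  show "x \<in> exterior_ideal M \<Longrightarrow> y \<in> exterior_ideal M \<Longrightarrow> x - y \<in> exterior_ideal M"
    using add[of x "- y"] neg[of y] by simp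
  show "x \<in> exterior_ideal M \<Longrightarrow> Poly_Mapping.keys a \<subseteq> lists M \<Longrightarrow> frag_mult (@) a x \<in> exterior_ideal M"
    using ideal.I_l_closed[OF exterior_ideal_ideal, of x M a] by (simp add: free_ring_simps)
  show "x \<in> exterior_ideal M \<Longrightarrow> Poly_Mapping.keys a \<subseteq> lists M \<Longrightarrow> frag_mult (@) x a \<in> exterior_ideal M"
    using ideal.I_r_closed[OF exterior_ideal_ideal, of x M a] by (simp add: free_ring_simps)
qed

lemma exterior_ideal_square:
  assumes "v \<in> free_ring_degree_one M"
  shows "frag_mult (@) v v \<in> exterior_ideal M"
proof -
  have "v \<otimes>\<^bsub>free_ring M\<^esub> v \<in> exterior_ideal M"
    unfolding exterior_ideal_def
    by (intro subsetD[OF free.genideal_self]) (use assms in \<open>auto simp: free_degree_one_carrier\<close>)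
  then show ?thesis
    by (simp add: free_ring_simps(2))
qed

text \<open>The grading involution. It carries the sign (-1)^deg of the graded Leibniz rule in a
  form that also makes sense for inhomogeneous elements.\<close>

definition grade_inv :: "('m list \<Rightarrow>\<^sub>0 int) \<Rightarrow> 'm list \<Rightarrow>\<^sub>0 int" where
  "grade_inv = frag_extend (\<lambda>w. frag_cmul ((-1) ^ length w) (frag_of w))"

lemma frag_mult_cmul_left: "frag_mult m (frag_cmul c x) y = frag_cmul c (frag_mult m x y)"
  by (simp add: frag_mult_def frag_extend_cmul)

lemma frag_mult_cmul_right: "frag_mult m x (frag_cmul c y) = frag_cmul c (frag_mult m x y)"
  by (simp add: frag_mult_def frag_extend_cmul) (simp add: frag_extend_def frag_cmul_sum mult.left_commute)

lemma grade_inv_mult: "grade_inv (frag_mult (@) x y) = frag_mult (@) (grade_inv x) (grade_inv y)"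
  using subset_UNIV subset_UNIV
  by (induction rule: frag_mult_induct[where x=x and y=y])
    (auto simp: grade_inv_def frag_mult_diff_left frag_mult_diff_right frag_extend_diff
       frag_mult_cmul_left frag_mult_cmul_right power_add mult.commute)

lemma keys_grade_inv: "Poly_Mapping.keys (grade_inv x) \<subseteq> Poly_Mapping.keys x"
  unfolding grade_inv_def by (rule order_trans[OF keys_frag_extend]) auto

lemma sum_lessThan_add: "sum f {..<m + n} = sum f {..<m} + (\<Sum>i<n. f (m + i))"
  for f :: "nat \<Rightarrow> 'a::comm_monoid_add"
  by (induction n) (simp_all add: add.assoc)

text \<open>A letter deleted from \<open>v @ w\<close> comes from \<open>v\<close> or from
  \<open>w\<close>. In the second case its position is shifted by \<open>length v\<close>, and the
  extra sign is the one that \<open>grade_inv\<close> puts on \<open>v\<close>.\<close>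

lemma free_deriv_word_append:
  "free_deriv (frag_of (v @ w)) =
     frag_mult (@) (free_deriv (frag_of v)) (frag_of w) +
     frag_mult (@) (grade_inv (frag_of v)) (free_deriv (frag_of w))"
proof -
  let ?t = "\<lambda>w i. frag_cmul ((-1) ^ i) (frag_of (take i w @ drop (Suc i) w)) :: 'a list \<Rightarrow>\<^sub>0 int"
  have "free_deriv (frag_of (v @ w)) = (\<Sum>i<length v + length w. ?t (v @ w) i)"
    by (simp add: free_deriv_def)
  also have "\<dots> = (\<Sum>i<length v. ?t (v @ w) i) + (\<Sum>i<length w. ?t (v @ w) (length v + i))"
    by (rule sum_lessThan_add)
  also have "(\<Sum>i<length v. ?t (v @ w) i) = frag_mult (@) (free_deriv (frag_of v)) (frag_of w)"
    by (simp add: free_deriv_def frag_mult_sum_left frag_mult_cmul_left)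
  also have "(\<Sum>i<length w. ?t (v @ w) (length v + i)) =
      frag_mult (@) (grade_inv (frag_of v)) (free_deriv (frag_of w))"
    by (simp add: free_deriv_def grade_inv_def frag_mult_sum_right frag_mult_cmul_left
        frag_mult_cmul_right power_add mult.commute frag_cmul_sum)
  finally show ?thesis .
qed

lemma free_deriv_diff: "free_deriv (x - y) = free_deriv x - free_deriv y"
  by (simp add: free_deriv_def frag_extend_diff)

lemma free_deriv_zero: "free_deriv 0 = 0"
  by (simp add: free_deriv_def)

lemma free_deriv_mult:
  "free_deriv (frag_mult (@) x y) = frag_mult (@) (free_deriv x) y + frag_mult (@) (grade_inv x) (free_deriv y)"
  using subset_UNIV subset_UNIV
  by (induction rule: frag_mult_induct[where x=x and y=y])
    (auto simp: free_deriv_word_append frag_mult_diff_left frag_mult_diff_right free_deriv_diff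
        free_deriv_zero grade_inv_def frag_extend_diff)

lemma keys_free_deriv:
  assumes "Poly_Mapping.keys x \<subseteq> lists M"
  shows "Poly_Mapping.keys (free_deriv x) \<subseteq> lists M"
  unfolding free_deriv_def
proof (intro order_trans[OF keys_frag_extend] UN_least order_trans[OF keys_sum])
  fix w i assume "w \<in> Poly_Mapping.keys x"
  then have "take i w @ drop (Suc i) w \<in> lists M"
    using assms by (meson append_in_lists_conv append_take_drop_id in_listsD in_lists_conv_set in_set_dropD in_set_takeD subsetD)
  then show "Poly_Mapping.keys (frag_cmul ((-1) ^ i) (frag_of (take i w @ drop (Suc i) w))) \<subseteq> lists M"
    using keys_cmul by fastforce
qed

lemma degree_one_induct [consumes 1, case_names zero one diff]:
  assumes "v \<in> free_ring_degree_one M" "P 0" "\<And>u. u \<in> M \<Longrightarrow> P (frag_of [u])"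
    "\<And>x y. P x \<Longrightarrow> P y \<Longrightarrow> P (x - y)"
  shows "P v"
proof -
  have "Poly_Mapping.keys v \<subseteq> (\<lambda>u. [u]) ` M"
    using assms(1) unfolding free_ring_degree_one_def free_ring_simps
    by (force simp: length_Suc_conv)
  then show ?thesis
    by (induction rule: frag_induction) (use assms in auto)
qed

text \<open>This is what makes the derivation descend to the exterior algebra.\<close>

lemma free_deriv_exterior_ideal:
  assumes "x \<in> exterior_ideal M"
  shows "free_deriv x \<in> exterior_ideal M"
proof -
  \<comment> \<open>The Leibniz rule for a product x a contains \<open>grade_inv x\<close>, so
    closure under multiplication from the right forces the condition on \<open>grade_inv\<close>
    into \<open>J\<close>.\<close>
  define J where "J = {x \<in> exterior_ideal M. grade_inv x \<in> exterior_ideal M \<and> free_deriv x \<in> exterior_ideal M}"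
  have "ideal J (free_ring M)"
  proof (rule free_idealI)
    show "J \<subseteq> carrier (free_ring M)"
      by (auto simp: J_def free_ring_simps(1) simp del: in_lists_conv_set dest: exterior_ideal_closed(2))
  qed (auto simp: J_def exterior_ideal_closed free_deriv_diff free_deriv_zero grade_inv_def
       frag_extend_diff free_ring_simps(1) free_deriv_mult keys_free_deriv
       grade_inv_mult[unfolded grade_inv_def] keys_grade_inv[unfolded grade_inv_def, THEN order_trans])
  moreover have "frag_mult (@) v v \<in> J" if v: "v \<in> free_ring_degree_one M" for v
  proof -
    have 1: "grade_inv v = - v"
      using v by (induction rule: degree_one_induct) (auto simp: grade_inv_def frag_extend_diff)
    \<comment> \<open>In degree one the derivative is an integer c, so the derivative of v v is c v
      - v c = 0.\<close>
    have "\<exists>c. free_deriv v = frag_cmul c (frag_of [])"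
      using v
    proof (induction rule: degree_one_induct)
      case zero
      show ?case by (rule exI[of _ 0]) (simp add: free_deriv_zero)
    next
      case (one u)
      show ?case by (rule exI[of _ 1]) (simp add: free_deriv_def)
    qed (metis frag_cmul_diff_distrib free_deriv_diff)
    then have "free_deriv (frag_mult (@) v v) = 0"
      by (auto simp: free_deriv_mult 1 frag_mult_minus_left frag_mult_cmul_left frag_mult_cmul_right)
    then show ?thesis
      using v 1
      by (simp add: J_def exterior_ideal_square exterior_ideal_closed grade_inv_mult
          frag_mult_minus_left frag_mult_minus_right)
  qed
  ultimately have "exterior_ideal M \<subseteq> J"
    unfolding exterior_ideal_def by (intro free.genideal_minimal) (auto simp: free_ring_simps(2))
  then show ?thesis
    using assms by (auto simp: J_def)
qed

section \<open>Circuit relations\<close>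

lemma simple_circuit_length:
  assumes "simple_matroid M indep" "circuit M indep (set us)"
  shows "3 \<le> length us"
proof (rule ccontr)
  assume "\<not> 3 \<le> length us"
  then have "card (set us) \<le> 2"
    using card_length[of us] by linarith
  then show False
    using assms by (auto simp: simple_matroid_def circuit_def)
qed

abbreviation ext_class :: "'m set \<Rightarrow> ('m list \<Rightarrow>\<^sub>0 int) \<Rightarrow> ('m list \<Rightarrow>\<^sub>0 int) set" where
  "ext_class M x \<equiv> exterior_ideal M +>\<^bsub>free_ring M\<^esub> x"

lemma ring_exterior_algebra: "ring (exterior_algebra M)"
  unfolding exterior_algebra_def by (rule ideal.quotient_is_ring[OF exterior_ideal_ideal])

lemma ext_class_hom: "ext_class M \<in> ring_hom (free_ring M) (exterior_algebra M)"
  unfolding exterior_algebra_def by (rule ideal.rcos_ring_hom[OF exterior_ideal_ideal])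

lemma ext_class_closed: "Poly_Mapping.keys x \<subseteq> lists M \<Longrightarrow> ext_class M x \<in> carrier (exterior_algebra M)"
  using ring_hom_closed[OF ext_class_hom] by (simp add: free_ring_simps(1))

lemma ext_class_mult:
  "Poly_Mapping.keys x \<subseteq> lists M \<Longrightarrow> Poly_Mapping.keys y \<subseteq> lists M \<Longrightarrow>
    ext_class M x \<otimes>\<^bsub>exterior_algebra M\<^esub> ext_class M y = ext_class M (frag_mult (@) x y)"
  using ring_hom_mult[OF ext_class_hom, of x M y] by (simp add: free_ring_simps)

lemma ext_class_add:
  "Poly_Mapping.keys x \<subseteq> lists M \<Longrightarrow> Poly_Mapping.keys y \<subseteq> lists M \<Longrightarrow>
    ext_class M x \<oplus>\<^bsub>exterior_algebra M\<^esub> ext_class M y = ext_class M (x + y)"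
  using ring_hom_add[OF ext_class_hom, of x M y] by (simp add: free_ring_simps)

lemma ext_class_zero: "x \<in> exterior_ideal M \<Longrightarrow> ext_class M x = \<zero>\<^bsub>exterior_algebra M\<^esub>"
  using ring.a_rcos_zero[OF ring_free_ring exterior_ideal_ideal]
  by (simp add: exterior_algebra_def FactRing_def)

lemma ext_class_one: "\<one>\<^bsub>exterior_algebra M\<^esub> = ext_class M (frag_of [])"
  by (simp add: exterior_algebra_def FactRing_def free_ring_simps)

lemma mem_ext_class: "y \<in> ext_class M x \<longleftrightarrow> (\<exists>h\<in>exterior_ideal M. y = h + x)"
  by (auto simp: a_r_coset_def' free_ring_simps)

lemma ext_carrierE:
  assumes "X \<in> carrier (exterior_algebra M)"
  obtains x where "Poly_Mapping.keys x \<subseteq> lists M" "X = ext_class M x"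
  using assms unfolding exterior_algebra_def FactRing_def A_RCOSETS_def'
  by (auto simp: free_ring_simps(1) simp del: in_lists_conv_set)

lemma ext_class_add_ideal:
  assumes "h \<in> exterior_ideal M" "Poly_Mapping.keys x \<subseteq> lists M"
  shows "ext_class M (h + x) = ext_class M x"
proof -
  interpret E: ring "exterior_algebra M"
    by (rule ring_exterior_algebra)
  have "ext_class M (h + x) = ext_class M h \<oplus>\<^bsub>exterior_algebra M\<^esub> ext_class M x"
    using assms by (simp add: ext_class_add exterior_ideal_closed(2))
  then show ?thesis
    using assms by (simp add: ext_class_zero ext_class_closed)
qed

lemma ext_prod_eq: "us \<in> lists M \<Longrightarrow> ext_prod M us = ext_class M (frag_of us)"
proof (induction us)
  case Nil
  then show ?case
    by (simp add: ext_prod_def ext_class_one)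
next
  case (Cons u us)
  then have "ext_prod M (u # us) = ext_class M (frag_of [u]) \<otimes>\<^bsub>exterior_algebra M\<^esub> ext_class M (frag_of us)"
    by (simp add: ext_prod_def ext_gen_def)
  also have "\<dots> = ext_class M (frag_of (u # us))"
    using Cons.prems by (subst ext_class_mult) auto
  finally show ?case .
qed

text \<open>\<open>ext_deriv\<close> is a union over all representatives of a coset. Any two differ
  by an element of the exterior ideal, whose derivative stays in that ideal, so all members of the
  union are one and the same class.\<close>

lemma ext_deriv_ext_class:
  assumes "Poly_Mapping.keys x \<subseteq> lists M"
  shows "ext_deriv M (ext_class M x) = ext_class M (free_deriv x)"
proof -
  have "ext_class M (free_deriv y) = ext_class M (free_deriv x)" if y: "y \<in> ext_class M x" for y
  proof -
    from y obtain h where h: "h \<in> exterior_ideal M" "y = h + x"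
      by (auto simp: mem_ext_class)
    have "free_deriv y = free_deriv h + free_deriv x"
      by (simp add: h free_deriv_def frag_extend_add)
    then show ?thesis
      using h assms by (simp add: ext_class_add_ideal free_deriv_exterior_ideal keys_free_deriv)
  qed
  moreover have "x \<in> ext_class M x"
    using exterior_ideal_closed(1) by (force simp: mem_ext_class)
  ultimately show ?thesis
    unfolding ext_deriv_def by blast
qed

lemma os_relation_eq:
  assumes "circuit M indep (set us)"
  shows "ext_deriv M (ext_prod M us) = ext_class M (free_deriv (frag_of us))"
proof -
  have "us \<in> lists M"
    using assms by (auto simp: circuit_def)
  then show ?thesis
    by (simp add: ext_prod_eq ext_deriv_ext_class)
qed

lemma os_relations_carrier:
  "{ext_deriv M (ext_prod M us) |us. distinct us \<and> circuit M indep (set us)} \<subseteq> carrier (exterior_algebra M)"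
proof -
  have "ext_deriv M (ext_prod M us) \<in> carrier (exterior_algebra M)" if "circuit M indep (set us)" for us
    unfolding os_relation_eq[OF that]
    using that by (intro ext_class_closed keys_free_deriv) (auto simp: circuit_def)
  then show ?thesis
    by blast
qed

lemma os_ideal_ideal: "ideal (os_ideal M indep) (exterior_algebra M)"
  unfolding os_ideal_def
  by (rule ring.genideal_ideal[OF ring_exterior_algebra os_relations_carrier])

section \<open>The Orlik-Solomon ring and its quadratic relations\<close>

lemma ring_orlik_solomon: "ring (orlik_solomon M indep)"
  unfolding orlik_solomon_def by (rule ideal.quotient_is_ring[OF os_ideal_ideal])

lemma os_class_hom: "os_class M indep \<in> ring_hom (free_ring M) (orlik_solomon M indep)"
proof -
  have "(\<lambda>X. os_ideal M indep +>\<^bsub>exterior_algebra M\<^esub> X) \<circ> ext_class M \<in> ring_hom (free_ring M) (orlik_solomon M indep)"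
    unfolding orlik_solomon_def
    by (rule ring_hom_trans[OF ext_class_hom ideal.rcos_ring_hom[OF os_ideal_ideal]])
  moreover have "(\<lambda>X. os_ideal M indep +>\<^bsub>exterior_algebra M\<^esub> X) \<circ> ext_class M = os_class M indep"
    by (auto simp: os_class_def)
  ultimately show ?thesis by simp
qed

lemma os_class_closed: "Poly_Mapping.keys x \<subseteq> lists M \<Longrightarrow> os_class M indep x \<in> carrier (orlik_solomon M indep)"
  using ring_hom_closed[OF os_class_hom] by (simp add: free_ring_simps(1))

lemma os_class_mult:
  "Poly_Mapping.keys x \<subseteq> lists M \<Longrightarrow> Poly_Mapping.keys y \<subseteq> lists M \<Longrightarrow>
    os_class M indep x \<otimes>\<^bsub>orlik_solomon M indep\<^esub> os_class M indep y = os_class M indep (frag_mult (@) x y)"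
  using ring_hom_mult[OF os_class_hom, of x M y] by (simp add: free_ring_simps)

lemma os_class_add:
  "Poly_Mapping.keys x \<subseteq> lists M \<Longrightarrow> Poly_Mapping.keys y \<subseteq> lists M \<Longrightarrow>
    os_class M indep x \<oplus>\<^bsub>orlik_solomon M indep\<^esub> os_class M indep y = os_class M indep (x + y)"
  using ring_hom_add[OF os_class_hom, of x M y] by (simp add: free_ring_simps)

lemma os_class_zero:
  "ext_class M x \<in> os_ideal M indep \<Longrightarrow> os_class M indep x = \<zero>\<^bsub>orlik_solomon M indep\<^esub>"
  using ring.a_rcos_zero[OF ring_exterior_algebra os_ideal_ideal]
  by (simp add: os_class_def orlik_solomon_def FactRing_def)

lemma os_class_exterior_ideal:
  "x \<in> exterior_ideal M \<Longrightarrow> os_class M indep x = \<zero>\<^bsub>orlik_solomon M indep\<^esub>"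
  by (rule os_class_zero)
    (simp add: ext_class_zero additive_subgroup.zero_closed[OF ideal.axioms(1)[OF os_ideal_ideal]])

lemma os_class_circuit:
  assumes "distinct us" "circuit M indep (set us)"
  shows "os_class M indep (free_deriv (frag_of us)) = \<zero>\<^bsub>orlik_solomon M indep\<^esub>"
proof (rule os_class_zero)
  have "ext_deriv M (ext_prod M us) \<in> os_ideal M indep"
    unfolding os_ideal_def
    by (rule subsetD[OF ring.genideal_self[OF ring_exterior_algebra os_relations_carrier]])
      (use assms in blast)
  then show "ext_class M (free_deriv (frag_of us)) \<in> os_ideal M indep"
    by (simp add: os_relation_eq[OF assms(2)])
qed

lemma os_carrierE:
  assumes "X \<in> carrier (orlik_solomon M indep)"
  obtains x where "Poly_Mapping.keys x \<subseteq> lists M" "X = os_class M indep x"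
proof -
  obtain Y where "Y \<in> carrier (exterior_algebra M)" "X = os_ideal M indep +>\<^bsub>exterior_algebra M\<^esub> Y"
    using assms unfolding orlik_solomon_def FactRing_def A_RCOSETS_def' by auto
  then show ?thesis
    by (metis ext_carrierE os_class_def that)
qed

abbreviation os_gen :: "'m set \<Rightarrow> ('m set \<Rightarrow> bool) \<Rightarrow> 'm \<Rightarrow> ('m list \<Rightarrow>\<^sub>0 int) set set" where
  "os_gen M indep u \<equiv> os_class M indep (frag_of [u])"

lemma os_gen_closed: "u \<in> M \<Longrightarrow> os_gen M indep u \<in> carrier (orlik_solomon M indep)"
  by (rule os_class_closed) simp

lemma os_gen_mult:
  "u \<in> M \<Longrightarrow> v \<in> M \<Longrightarrow>
    os_gen M indep u \<otimes>\<^bsub>orlik_solomon M indep\<^esub> os_gen M indep v = os_class M indep (frag_of [u, v])"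
  by (subst os_class_mult) auto

lemma frag_of_degree_one: "u \<in> M \<Longrightarrow> frag_of [u] \<in> free_ring_degree_one M"
  by (simp add: free_ring_degree_one_def free_ring_simps)

lemma os_gen_square:
  "u \<in> M \<Longrightarrow> os_gen M indep u \<otimes>\<^bsub>orlik_solomon M indep\<^esub> os_gen M indep u = \<zero>\<^bsub>orlik_solomon M indep\<^esub>"
  using exterior_ideal_square[OF frag_of_degree_one, of u M]
  by (simp add: os_gen_mult os_class_exterior_ideal)

lemma os_gen_anticommute:
  assumes "u \<in> M" "v \<in> M"
  shows "os_gen M indep u \<otimes>\<^bsub>orlik_solomon M indep\<^esub> os_gen M indep v \<oplus>\<^bsub>orlik_solomon M indep\<^esub>
    os_gen M indep v \<otimes>\<^bsub>orlik_solomon M indep\<^esub> os_gen M indep u = \<zero>\<^bsub>orlik_solomon M indep\<^esub>"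
proof -
  let ?s = "frag_of [u] + frag_of [v] :: 'a list \<Rightarrow>\<^sub>0 int"
  have "?s \<in> free_ring_degree_one M"
    unfolding free_ring_degree_one_def free_ring_simps using assms keys_add[of "frag_of [u]" "frag_of [v]"] by force
  then have "frag_mult (@) ?s ?s - frag_mult (@) (frag_of [u]) (frag_of [u]) - frag_mult (@) (frag_of [v]) (frag_of [v]) \<in> exterior_ideal M"
    using assms by (intro exterior_ideal_closed exterior_ideal_square frag_of_degree_one)
  also have "frag_mult (@) ?s ?s - frag_mult (@) (frag_of [u]) (frag_of [u]) - frag_mult (@) (frag_of [v]) (frag_of [v]) = frag_of [u, v] + frag_of [v, u]"
    by (simp add: frag_mult_add_left frag_mult_add_right)
  finally show ?thesis
    using assms by (simp add: os_gen_mult os_class_add os_class_exterior_ideal)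
qed

text \<open>This is \<open>e\<^sub>u e\<^sub>v = (e\<^sub>u - e\<^sub>v) e\<^sub>w\<close>, with both sides moved so that no subtraction occurs.\<close>

lemma os_gen_relation:
  assumes "simple_matroid M indep" "u \<in> M" "v \<in> M" "w \<in> M"
    and "card {u, v, w} = 3 \<Longrightarrow> \<not> indep {u, v, w}"
  shows "os_gen M indep u \<otimes>\<^bsub>orlik_solomon M indep\<^esub> os_gen M indep v \<oplus>\<^bsub>orlik_solomon M indep\<^esub>
      os_gen M indep v \<otimes>\<^bsub>orlik_solomon M indep\<^esub> os_gen M indep w =
    os_gen M indep u \<otimes>\<^bsub>orlik_solomon M indep\<^esub> os_gen M indep w"
proof -
  interpret O: ring "orlik_solomon M indep"
    by (rule ring_orlik_solomon)
  note gen_closed = os_gen_closed[of _ M indep]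
  \<comment> \<open>If two of the three coincide, the relation reduces to vanishing squares or, for
    \<open>u = w\<close>, to anticommutation.\<close>
  consider "u = v" | "v = w" | "u = w" | "distinct [u, v, w]"
    by auto
  then show ?thesis
  proof cases
    case 3
    then show ?thesis
      using assms by (simp add: os_gen_square os_gen_anticommute)
  next
    case 4
    then have card: "card {u, v, w} = 3" by simp
    \<comment> \<open>Proper subsets of the triple have at most two elements, hence are independent.
      The circuit relation is then d(e_u e_v e_w) = e_v e_w - e_u e_w + e_u e_v = 0.\<close>
    have "circuit M indep {u, v, w}"
    proof -
      have "indep T" if "T \<subset> {u, v, w}" for T
      proof -
        have "card T < 3"
          using psubset_card_mono[OF _ that] card by simp
        then show ?thesis
          using assms(1-4) that unfolding simple_matroid_def
          by (metis insert_subset less_Suc_eq_le numeral_2_eq_2 numeral_3_eq_3 order_trans psubset_imp_subset empty_subsetI)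
      qed
      then show ?thesis
        using assms card by (auto simp: circuit_def)
    qed
    have keys: "Poly_Mapping.keys (frag_of [u, v] + frag_of [v, w]) \<subseteq> lists M"
      "Poly_Mapping.keys (- frag_of [u, w]) \<subseteq> lists M"
      using assms by (intro keys_add_subset; simp) (use assms in \<open>simp add: keys_minus\<close>)
    from \<open>circuit M indep {u, v, w}\<close>
    have "os_class M indep (free_deriv (frag_of [u, v, w])) = \<zero>\<^bsub>orlik_solomon M indep\<^esub>"
      using 4 by (intro os_class_circuit) auto
    also have "free_deriv (frag_of [u, v, w]) = frag_of [u, v] + frag_of [v, w] + (- frag_of [u, w])"
      by (simp add: free_deriv_def numeral_3_eq_3 eval_nat_numeral)
    finally have "os_class M indep (frag_of [u, v] + frag_of [v, w]) \<oplus>\<^bsub>orlik_solomon M indep\<^esub>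
        os_class M indep (- frag_of [u, w]) = \<zero>\<^bsub>orlik_solomon M indep\<^esub>"
      using keys by (simp add: os_class_add)
    moreover have "os_class M indep (frag_of [u, w]) \<oplus>\<^bsub>orlik_solomon M indep\<^esub>
        os_class M indep (- frag_of [u, w]) = \<zero>\<^bsub>orlik_solomon M indep\<^esub>"
      using assms by (subst os_class_add) (auto simp: os_class_exterior_ideal exterior_ideal_closed)
    moreover have "os_class M indep (frag_of [u, v] + frag_of [v, w]) \<in> carrier (orlik_solomon M indep)"
      "os_class M indep (- frag_of [u, w]) \<in> carrier (orlik_solomon M indep)"
      "os_class M indep (frag_of [u, w]) \<in> carrier (orlik_solomon M indep)"
      using assms by (intro os_class_closed keys_add_subset; simp)+
    \<comment> \<open>Both classes are the additive inverse of the class of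
      \<open>- frag_of [u, w]\<close>.\<close>
    ultimately have "os_class M indep (frag_of [u, v] + frag_of [v, w]) = os_class M indep (frag_of [u, w])"
      by (metis O.add.inv_equality O.minus_minus)
    then show ?thesis
      using assms by (simp add: os_gen_mult os_class_add)
  qed (use assms gen_closed in \<open>simp_all add: os_gen_square\<close>)
qed

definition degree_ge_two :: "'m set \<Rightarrow> ('m list \<Rightarrow>\<^sub>0 int) set" where
  "degree_ge_two M = {x. Poly_Mapping.keys x \<subseteq> {w \<in> lists M. 2 \<le> length w}}"

lemma degree_ge_two_ideal: "ideal (degree_ge_two M) (free_ring M)"
proof (rule free_idealI)
  fix a x assume ax: "a \<in> carrier (free_ring M)" "x \<in> degree_ge_two M"
  show "frag_mult (@) a x \<in> degree_ge_two M" "frag_mult (@) x a \<in> degree_ge_two M"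
    using ax keys_frag_mult[of "(@)" a x] keys_frag_mult[of "(@)" x a]
    by (fastforce simp: degree_ge_two_def free_ring_simps(1))+
next
  show "degree_ge_two M \<subseteq> carrier (free_ring M)"
    by (fastforce simp: degree_ge_two_def free_ring_simps(1))
qed (simp_all add: degree_ge_two_def keys_diff_subset)

lemma exterior_ideal_degree_ge_two: "exterior_ideal M \<subseteq> degree_ge_two M"
  unfolding exterior_ideal_def
proof (rule free.genideal_minimal[OF degree_ge_two_ideal], clarify)
  fix v assume "v \<in> free_ring_degree_one M"
  then show "v \<otimes>\<^bsub>free_ring M\<^esub> v \<in> degree_ge_two M"
    using keys_frag_mult[of "(@)" v v]
    by (fastforce simp: degree_ge_two_def free_ring_simps free_ring_degree_one_def)
qed

text \<open>Circuits of a simple matroid have at least three elements, so deleting one letter leaves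
  words of length at least two. The image of an ideal in a quotient ring is an ideal, hence it
  contains the ideal generated by these relations.\<close>

lemma os_ideal_degree_ge_two:
  assumes "simple_matroid M indep"
  shows "os_ideal M indep \<subseteq> ext_class M ` degree_ge_two M"
  unfolding os_ideal_def
proof (rule ring.genideal_minimal[OF ring_exterior_algebra])
  show "ideal (ext_class M ` degree_ge_two M) (exterior_algebra M)"
    unfolding exterior_algebra_def
    by (rule free.ring_ideal_imp_quot_ideal[OF exterior_ideal_ideal degree_ge_two_ideal])
  have "free_deriv (frag_of us) \<in> degree_ge_two M" if us: "circuit M indep (set us)" for us
  proof -
    have "3 \<le> length us" "us \<in> lists M"
      using simple_circuit_length[OF assms us] us by (auto simp: circuit_def)
    then show ?thesis
      unfolding degree_ge_two_def free_deriv_def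
      by (auto dest!: subsetD[OF keys_sum] dest!: in_set_takeD in_set_dropD split: if_splits)
  qed
  then show "{ext_deriv M (ext_prod M us) |us. distinct us \<and> circuit M indep (set us)}
      \<subseteq> ext_class M ` degree_ge_two M"
    using os_relation_eq by fastforce
qed

text \<open>An element of the Orlik-Solomon ring is a coset of cosets, so its union is the set of
  all its representatives in the free ring. \<open>SOME\<close> picks one of them; for a simple
  matroid the coefficient of a one-letter word does not depend on the choice.\<close>

definition os_coeff :: "'m \<Rightarrow> ('m list \<Rightarrow>\<^sub>0 int) set set \<Rightarrow> int" where
  "os_coeff u X = Poly_Mapping.lookup (SOME x. x \<in> \<Union>X) [u]"

text \<open>Every representative is \<open>h + (d + x)\<close> with \<open>h\<close> in the exterior
  ideal and \<open>d\<close> in degree at least two, and neither of these contains the word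
  \<open>[u]\<close>.\<close>

lemma os_coeff_os_class:
  assumes "simple_matroid M indep" "Poly_Mapping.keys x \<subseteq> lists M"
  shows "os_coeff u (os_class M indep x) = Poly_Mapping.lookup x [u]"
proof -
  have low: "Poly_Mapping.lookup d [u] = 0" if "d \<in> degree_ge_two M" for d
    using that by (force simp: degree_ge_two_def in_keys_iff)
  have eq: "Poly_Mapping.lookup y [u] = Poly_Mapping.lookup x [u]" if y: "y \<in> \<Union>(os_class M indep x)" for y
  proof -
    from y obtain Y where "y \<in> Y" "Y \<in> os_class M indep x" by blast
    then obtain d where d: "d \<in> degree_ge_two M"
        "y \<in> ext_class M d \<oplus>\<^bsub>exterior_algebra M\<^esub> ext_class M x"
      using os_ideal_degree_ge_two[OF assms(1)] by (force simp: os_class_def a_r_coset_def')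
    moreover have "Poly_Mapping.keys d \<subseteq> lists M"
      using d(1) by (auto simp: degree_ge_two_def)
    ultimately obtain h where "h \<in> exterior_ideal M" "y = h + (d + x)"
      using assms by (auto simp: ext_class_add mem_ext_class)
    then show ?thesis
      using low[of h] low[OF d(1)] exterior_ideal_degree_ge_two by (auto simp: lookup_add)
  qed
  interpret E: ring "exterior_algebra M"
    by (rule ring_exterior_algebra)
  have "ext_class M x = \<zero>\<^bsub>exterior_algebra M\<^esub> \<oplus>\<^bsub>exterior_algebra M\<^esub> ext_class M x"
    using assms by (simp add: ext_class_closed)
  then have "ext_class M x \<in> os_class M indep x"
    using additive_subgroup.zero_closed[OF ideal.axioms(1)[OF os_ideal_ideal]]
    unfolding os_class_def a_r_coset_def' by blast
  moreover have "x \<in> ext_class M x"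
    using exterior_ideal_closed(1) by (force simp: mem_ext_class)
  ultimately have "\<exists>y. y \<in> \<Union>(os_class M indep x)"
    by blast
  then have "(SOME y. y \<in> \<Union>(os_class M indep x)) \<in> \<Union>(os_class M indep x)"
    by (rule someI_ex)
  then show ?thesis
    by (simp add: os_coeff_def eq)
qed

lemma os_coeff_add:
  assumes "simple_matroid M indep" "X \<in> carrier (orlik_solomon M indep)" "Y \<in> carrier (orlik_solomon M indep)"
  shows "os_coeff u (X \<oplus>\<^bsub>orlik_solomon M indep\<^esub> Y) = os_coeff u X + os_coeff u Y"
  using assms(2,3)
  by (elim os_carrierE) (simp add: os_class_add os_coeff_os_class assms(1) keys_add_subset lookup_add)

section \<open>Tensor products of algebras\<close>

text \<open>The laws under which a product and a scalar action pass to a tensor product.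
  Associativity and a unit are left out so that a Lie algebra, with its bracket as product,
  qualifies alongside rings.\<close>

locale scalar_algebra = abelian_group P
  for R :: "('r, 'x) ring_scheme" and P :: "('r, 'p, 'y) module_scheme" (structure) +
  assumes mult_closed: "p \<in> carrier P \<Longrightarrow> q \<in> carrier P \<Longrightarrow> p \<otimes> q \<in> carrier P"
    and mult_l_distr: "p \<in> carrier P \<Longrightarrow> p' \<in> carrier P \<Longrightarrow> q \<in> carrier P \<Longrightarrow>
      (p \<oplus> p') \<otimes> q = p \<otimes> q \<oplus> p' \<otimes> q"
    and mult_r_distr: "p \<in> carrier P \<Longrightarrow> q \<in> carrier P \<Longrightarrow> q' \<in> carrier P \<Longrightarrow>
      p \<otimes> (q \<oplus> q') = p \<otimes> q \<oplus> p \<otimes> q'"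
    and scalar_closed: "r \<in> carrier R \<Longrightarrow> p \<in> carrier P \<Longrightarrow> r \<odot> p \<in> carrier P"
    and scalar_r_distr: "r \<in> carrier R \<Longrightarrow> p \<in> carrier P \<Longrightarrow> p' \<in> carrier P \<Longrightarrow>
      r \<odot> (p \<oplus> p') = r \<odot> p \<oplus> r \<odot> p'"
    and scalar_commute: "r \<in> carrier R \<Longrightarrow> s \<in> carrier R \<Longrightarrow> p \<in> carrier P \<Longrightarrow>
      r \<odot> (s \<odot> p) = s \<odot> (r \<odot> p)"
    and scalar_mult_left: "r \<in> carrier R \<Longrightarrow> p \<in> carrier P \<Longrightarrow> q \<in> carrier P \<Longrightarrow>
      (r \<odot> p) \<otimes> q = r \<odot> (p \<otimes> q)"
    and scalar_mult_right: "r \<in> carrier R \<Longrightarrow> p \<in> carrier P \<Longrightarrow> q \<in> carrier P \<Longrightarrow>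
      p \<otimes> (r \<odot> q) = r \<odot> (p \<otimes> q)"

locale tensor = P: scalar_algebra R P + Q: scalar_algebra R Q
  for R :: "('r, 'x) ring_scheme" and P :: "('r, 'p, 'y) module_scheme"
    and Q :: "('r, 'q, 'z) module_scheme"
begin

abbreviation "pairs \<equiv> carrier P \<times> carrier Q"
abbreviation "N \<equiv> tensor_subgroup R P Q"
abbreviation "cl \<equiv> tensor_class R P Q"
abbreviation "T \<equiv> tensor_product R P Q"
abbreviation "pmult \<equiv> \<lambda>(p, q) (p', q'). (p \<otimes>\<^bsub>P\<^esub> p', q \<otimes>\<^bsub>Q\<^esub> q')"

lemma rels_keys: "h \<in> tensor_rels R P Q \<Longrightarrow> Poly_Mapping.keys h \<subseteq> pairs"
  unfolding tensor_rels_def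
  by (auto simp del: mem_Times_iff simp: P.scalar_closed Q.scalar_closed
      dest!: subsetD[OF keys_diff] split: if_splits)

lemma subgroup_keys: "h \<in> N \<Longrightarrow> Poly_Mapping.keys h \<subseteq> pairs"
  using group.generate_in_carrier[OF group_free_Abelian_group, of "tensor_rels R P Q" pairs h] rels_keys
  by (simp add: tensor_subgroup_def subset_eq)

lemma subgroup_zero: "0 \<in> N"
  using generate.one[of "free_Abelian_group pairs"] by (simp add: tensor_subgroup_def)

lemma subgroup_add: "g \<in> N \<Longrightarrow> h \<in> N \<Longrightarrow> g + h \<in> N"
  using generate.eng[of g "free_Abelian_group pairs"] by (simp add: tensor_subgroup_def)

lemma subgroup_uminus:
  assumes h: "h \<in> N"
  shows "- h \<in> N"
proof -
  have "tensor_rels R P Q \<subseteq> carrier (free_Abelian_group pairs)"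
    unfolding subset_eq carrier_free_Abelian_group_iff using rels_keys by (auto simp del: mem_Times_iff)
  from group.generate_m_inv_closed[OF group_free_Abelian_group this, of h]
  have "inv\<^bsub>free_Abelian_group pairs\<^esub> h \<in> N"
    using h by (simp add: tensor_subgroup_def)
  then show ?thesis
    using subgroup_keys[OF h] by simp
qed

lemma subgroup_diff: "g \<in> N \<Longrightarrow> h \<in> N \<Longrightarrow> g - h \<in> N"
  using subgroup_add[of g "- h"] subgroup_uminus by simp

lemma subgroup_sum: "(\<And>i. i \<in> I \<Longrightarrow> f i \<in> N) \<Longrightarrow> sum f I \<in> N"
  by (induction I rule: infinite_finite_induct) (auto simp: subgroup_zero subgroup_add)

lemma rel_add_left:
  "p \<in> carrier P \<Longrightarrow> p' \<in> carrier P \<Longrightarrow> q \<in> carrier Q \<Longrightarrow>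
    frag_of (p \<oplus>\<^bsub>P\<^esub> p', q) - frag_of (p, q) - frag_of (p', q) \<in> N"
  unfolding tensor_subgroup_def by (rule generate.incl) (auto simp: tensor_rels_def)

lemma rel_add_right:
  "p \<in> carrier P \<Longrightarrow> q \<in> carrier Q \<Longrightarrow> q' \<in> carrier Q \<Longrightarrow>
    frag_of (p, q \<oplus>\<^bsub>Q\<^esub> q') - frag_of (p, q) - frag_of (p, q') \<in> N"
  unfolding tensor_subgroup_def by (rule generate.incl) (auto simp: tensor_rels_def)

lemma rel_scalar:
  "r \<in> carrier R \<Longrightarrow> p \<in> carrier P \<Longrightarrow> q \<in> carrier Q \<Longrightarrow>
    frag_of (r \<odot>\<^bsub>P\<^esub> p, q) - frag_of (p, r \<odot>\<^bsub>Q\<^esub> q) \<in> N"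
  unfolding tensor_subgroup_def by (rule generate.incl) (auto simp: tensor_rels_def)

text \<open>With both second entries zero, the additivity relation collapses to minus this
  generator.\<close>

lemma rel_zero_right: "p \<in> carrier P \<Longrightarrow> frag_of (p, \<zero>\<^bsub>Q\<^esub>) \<in> N"
  using rel_add_right[of p "\<zero>\<^bsub>Q\<^esub>" "\<zero>\<^bsub>Q\<^esub>"] subgroup_uminus[of "- frag_of (p, \<zero>\<^bsub>Q\<^esub>)"] by simp

text \<open>The way to show that a map on the free group respects the tensor relations: additivity
  leaves only the three kinds of defining relation to test.\<close>

lemma subgroup_induct [consumes 1, case_names zero diff add_left add_right scalar]:
  assumes "h \<in> N" and zero: "H 0" and diff: "\<And>a b. H a \<Longrightarrow> H b \<Longrightarrow> H (a - b)"
    and "\<And>p p' q. p \<in> carrier P \<Longrightarrow> p' \<in> carrier P \<Longrightarrow> q \<in> carrier Q \<Longrightarrow>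
      H (frag_of (p \<oplus>\<^bsub>P\<^esub> p', q) - frag_of (p, q) - frag_of (p', q))"
    and "\<And>p q q'. p \<in> carrier P \<Longrightarrow> q \<in> carrier Q \<Longrightarrow> q' \<in> carrier Q \<Longrightarrow>
      H (frag_of (p, q \<oplus>\<^bsub>Q\<^esub> q') - frag_of (p, q) - frag_of (p, q'))"
    and "\<And>r p q. r \<in> carrier R \<Longrightarrow> p \<in> carrier P \<Longrightarrow> q \<in> carrier Q \<Longrightarrow>
      H (frag_of (r \<odot>\<^bsub>P\<^esub> p, q) - frag_of (p, r \<odot>\<^bsub>Q\<^esub> q))"
  shows "H h"
proof -
  have rel: "H h" if "h \<in> tensor_rels R P Q" for h
    using that unfolding tensor_rels_def
    by (elim UnE CollectE exE conjE) (simp_all only: assms(4-6))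
  have neg: "H (- a)" if "H a" for a
    using diff[OF zero that] by simp
  show ?thesis
    using assms(1) unfolding tensor_subgroup_def
  proof (induction rule: generate.induct)
    case (inv h)
    then show ?case
      using neg[OF rel] rels_keys[of h] by simp
  next
    case (eng a b)
    then show ?case
      using diff[OF _ neg[of b], of a] by simp
  qed (use zero rel in simp_all)
qed

text \<open>From here on, equality of tensors is tested by a difference lying in
  \<open>N\<close>.\<close>

lemma mem_class: "y \<in> cl x \<longleftrightarrow> y - x \<in> N"
proof
  show "y - x \<in> N \<Longrightarrow> y \<in> cl x"
    unfolding tensor_class_def r_coset_def by (rule UN_I[of "y - x"]) auto
qed (auto simp: tensor_class_def r_coset_def)

lemma class_eq:
  assumes *: "x - y \<in> N"
  shows "cl x = cl y"
proof -
  have "z - x \<in> N \<longleftrightarrow> z - y \<in> N" for z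
    using subgroup_add[OF _ *, of "z - x"] subgroup_diff[OF _ *, of "z - y"] by (auto simp: algebra_simps)
  then show ?thesis
    by (auto simp: mem_class)
qed

lemma class_self: "x \<in> cl x"
  by (simp add: mem_class subgroup_zero)

lemma tensor_carrier: "X \<in> carrier T \<longleftrightarrow> (\<exists>x. Poly_Mapping.keys x \<subseteq> pairs \<and> X = cl x)"
  unfolding tensor_product_def Let_def FactGroup_def RCOSETS_def tensor_class_def by (simp add: Bex_def)

lemma class_closed: "Poly_Mapping.keys x \<subseteq> pairs \<Longrightarrow> cl x \<in> carrier T"
  by (auto simp: tensor_carrier)

lemma tensor_zero: "\<zero>\<^bsub>T\<^esub> = cl 0"
  by (auto simp: tensor_product_def Let_def FactGroup_def mem_class)

lemma class_zero: "x \<in> N \<Longrightarrow> cl x = \<zero>\<^bsub>T\<^esub>"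
  by (simp add: tensor_zero class_eq)

lemma tensor_add: "cl x \<oplus>\<^bsub>T\<^esub> cl y = cl (x + y)"
proof -
  have "cl x \<oplus>\<^bsub>T\<^esub> cl y = {a + b |a b. a \<in> cl x \<and> b \<in> cl y}"
    by (auto simp: tensor_product_def Let_def FactGroup_def set_mult_def)
  also have "\<dots> = cl (x + y)"
  proof (intro Set.set_eqI iffI)
    fix z assume "z \<in> {a + b |a b. a \<in> cl x \<and> b \<in> cl y}"
    then obtain a b where "z = a + b" "a - x \<in> N" "b - y \<in> N"
      by (auto simp: mem_class)
    then show "z \<in> cl (x + y)"
      using subgroup_add[of "a - x" "b - y"] by (simp add: mem_class algebra_simps)
  next
    \<comment> \<open>Take \<open>y\<close> as representative of its own class; \<open>z - y\<close>
      then represents the class of \<open>x\<close>.\<close>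
    fix z assume "z \<in> cl (x + y)"
    then have "z - y \<in> cl x"
      by (simp add: mem_class algebra_simps)
    then show "z \<in> {a + b |a b. a \<in> cl x \<and> b \<in> cl y}"
      using class_self[of y] by force
  qed
  finally show ?thesis .
qed

lemma abelian_group_tensor: "abelian_group T"
proof (rule abelian_groupI)
  fix X assume "X \<in> carrier T"
  then obtain x where "Poly_Mapping.keys x \<subseteq> pairs" "X = cl x"
    by (auto simp: tensor_carrier)
  then show "\<exists>Y\<in>carrier T. Y \<oplus>\<^bsub>T\<^esub> X = \<zero>\<^bsub>T\<^esub>"
    by (intro bexI[of _ "cl (- x)"]) (auto simp: tensor_add tensor_zero intro!: class_closed)
next
  fix X Y assume "X \<in> carrier T" "Y \<in> carrier T"
  then show "X \<oplus>\<^bsub>T\<^esub> Y \<in> carrier T"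
    unfolding tensor_carrier by (metis keys_add_subset tensor_add)
qed (auto simp: tensor_carrier tensor_add tensor_zero ac_simps intro: exI[of _ 0])

text \<open>A defining relation multiplied by a single pair is again a relation of the same kind, by
  the distributive and scalar laws of the two factors. Together with the version for the other side,
  this makes \<open>N\<close> absorb products.\<close>

lemma pmult_subgroup_left:
  assumes "h \<in> N" "Poly_Mapping.keys y \<subseteq> pairs"
  shows "frag_mult pmult h y \<in> N"
  using assms(2)
proof (induction rule: frag_induction)
  case (one b)
  then obtain p q where b: "b = (p, q)" "p \<in> carrier P" "q \<in> carrier Q" by auto
  from assms(1) show ?case
    by (induction rule: subgroup_induct)
      (use b in \<open>auto simp: frag_mult_diff_left subgroup_zero subgroup_diff P.mult_closed Q.mult_closed
        P.mult_l_distr Q.mult_l_distr rel_add_left rel_add_right P.scalar_mult_left Q.scalar_mult_left rel_scalar\<close>)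
qed (auto simp: subgroup_zero frag_mult_diff_right subgroup_diff)

lemma pmult_subgroup_right:
  assumes "h \<in> N" "Poly_Mapping.keys x \<subseteq> pairs"
  shows "frag_mult pmult x h \<in> N"
  using assms(2)
proof (induction rule: frag_induction)
  case (one b)
  then obtain p q where b: "b = (p, q)" "p \<in> carrier P" "q \<in> carrier Q" by auto
  from assms(1) show ?case
    by (induction rule: subgroup_induct)
      (use b in \<open>auto simp: frag_mult_diff_right subgroup_zero subgroup_diff P.mult_closed Q.mult_closed
        P.mult_r_distr Q.mult_r_distr rel_add_left rel_add_right P.scalar_mult_right Q.scalar_mult_right rel_scalar\<close>)
qed (auto simp: subgroup_zero frag_mult_diff_left subgroup_diff)

lemma keys_pmult:
  assumes "Poly_Mapping.keys x \<subseteq> pairs" "Poly_Mapping.keys y \<subseteq> pairs"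
  shows "Poly_Mapping.keys (frag_mult pmult x y) \<subseteq> pairs"
proof (rule order_trans[OF keys_frag_mult])
  have "pmult a b \<in> pairs" if "a \<in> pairs" "b \<in> pairs" for a b
    using that P.mult_closed Q.mult_closed by (auto simp: case_prod_unfold)
  then show "{pmult a b |a b. a \<in> Poly_Mapping.keys x \<and> b \<in> Poly_Mapping.keys y} \<subseteq> pairs"
    using assms by blast
qed

lemma tensor_mult:
  assumes "Poly_Mapping.keys x \<subseteq> pairs" "Poly_Mapping.keys y \<subseteq> pairs"
  shows "cl x \<otimes>\<^bsub>T\<^esub> cl y = cl (frag_mult pmult x y)"
proof -
  have "cl (frag_mult pmult x' y') = cl (frag_mult pmult x y)" if "x' \<in> cl x" "y' \<in> cl y" for x' y'
  proof (rule class_eq)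
    from that have xy: "x' - x \<in> N" "y' - y \<in> N"
      by (auto simp: mem_class)
    \<comment> \<open>The difference x'y' - xy is split as (x' - x) y + x' (y' - y). The second term
      needs the support of \<open>x'\<close>, which is known only as a member of the class of
      \<open>x\<close>.\<close>
    have "Poly_Mapping.keys ((x' - x) + x) \<subseteq> pairs"
      using subgroup_keys[OF xy(1)] assms(1) by (rule keys_add_subset)
    then have "frag_mult pmult (x' - x) y + frag_mult pmult x' (y' - y) \<in> N"
      using xy assms by (intro subgroup_add pmult_subgroup_left pmult_subgroup_right) auto
    then show "frag_mult pmult x' y' - frag_mult pmult x y \<in> N"
      by (simp add: frag_mult_diff_left frag_mult_diff_right)
  qed
  moreover have "cl x \<otimes>\<^bsub>T\<^esub> cl y = (\<Union>x'\<in>cl x. \<Union>y'\<in>cl y. cl (frag_mult pmult x' y'))"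
    by (simp add: tensor_product_def Let_def frag_mult_def case_prod_unfold)
  ultimately show ?thesis
    using class_self[of x] class_self[of y] by blast
qed

lemma tensor_mult_closed: "X \<in> carrier T \<Longrightarrow> Y \<in> carrier T \<Longrightarrow> X \<otimes>\<^bsub>T\<^esub> Y \<in> carrier T"
  unfolding tensor_carrier by (metis keys_pmult tensor_mult)

lemma tensor_l_distr:
  "X \<in> carrier T \<Longrightarrow> X' \<in> carrier T \<Longrightarrow> Y \<in> carrier T \<Longrightarrow>
    (X \<oplus>\<^bsub>T\<^esub> X') \<otimes>\<^bsub>T\<^esub> Y = X \<otimes>\<^bsub>T\<^esub> Y \<oplus>\<^bsub>T\<^esub> X' \<otimes>\<^bsub>T\<^esub> Y"
  unfolding tensor_carrier
  by (elim exE conjE) (simp add: tensor_mult tensor_add keys_add_subset frag_mult_add_left)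

lemma tensor_r_distr:
  "X \<in> carrier T \<Longrightarrow> Y \<in> carrier T \<Longrightarrow> Y' \<in> carrier T \<Longrightarrow>
    X \<otimes>\<^bsub>T\<^esub> (Y \<oplus>\<^bsub>T\<^esub> Y') = X \<otimes>\<^bsub>T\<^esub> Y \<oplus>\<^bsub>T\<^esub> X \<otimes>\<^bsub>T\<^esub> Y'"
  unfolding tensor_carrier
  by (elim exE conjE) (simp add: tensor_mult tensor_add keys_add_subset frag_mult_add_right)

abbreviation "scale_left r \<equiv> frag_extend (\<lambda>(p, q). frag_of (r \<odot>\<^bsub>P\<^esub> p, q))"

lemma tensor_scalar:
  assumes "r \<in> carrier R"
  shows "r \<odot>\<^bsub>T\<^esub> cl x = cl (scale_left r x)"
proof -
  \<comment> \<open>Acting by r on the balancing relation for s gives the balancing relation for s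
    at r p once r and s are exchanged; this is the purpose of \<open>scalar_commute\<close>.\<close>
  have N: "scale_left r h \<in> N" if "h \<in> N" for h
    using that by (induction rule: subgroup_induct)
      (use assms in \<open>auto simp: frag_extend_diff subgroup_zero subgroup_diff P.scalar_closed Q.scalar_closed
        P.scalar_r_distr rel_add_left rel_add_right P.scalar_commute[of r] rel_scalar\<close>)
  have "cl (scale_left r y) = cl (scale_left r x)" if "y \<in> cl x" for y
    using that N[of "y - x"] by (intro class_eq) (simp add: mem_class frag_extend_diff)
  moreover have "r \<odot>\<^bsub>T\<^esub> cl x = (\<Union>y\<in>cl x. cl (scale_left r y))"
    by (simp add: tensor_product_def Let_def)
  ultimately show ?thesis
    using class_self[of x] by blast
qed

lemma finsum_class:
  assumes "finite A" "\<And>i. i \<in> A \<Longrightarrow> Poly_Mapping.keys (f i) \<subseteq> pairs"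
  shows "finsum T (\<lambda>i. cl (f i)) A = cl (sum f A)"
proof -
  interpret T: abelian_group T
    by (rule abelian_group_tensor)
  from assms show ?thesis
  proof (induction rule: finite_induct)
    case (insert a A)
    have "finsum T (\<lambda>i. cl (f i)) (insert a A) = cl (f a) \<oplus>\<^bsub>T\<^esub> finsum T (\<lambda>i. cl (f i)) A"
      using insert.hyps insert.prems by (intro T.finsum_insert) (auto intro!: class_closed)
    then show ?case
      using insert by (simp add: tensor_add)
  qed (simp add: tensor_zero)
qed

text \<open>The universal property in the form used for coefficients: a map on the free group that
  is additive and respects the relations kills \<open>N\<close>, so its value at an arbitrarily
  chosen member of a class is well defined.\<close>

lemma additive_on_class:
  fixes f :: "('p \<times> 'q \<Rightarrow>\<^sub>0 int) \<Rightarrow> 'c::ab_group_add"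
  assumes diff: "\<And>x y. f (x - y) = f x - f y"
    and "\<And>p p' q. p \<in> carrier P \<Longrightarrow> p' \<in> carrier P \<Longrightarrow> q \<in> carrier Q \<Longrightarrow>
      f (frag_of (p \<oplus>\<^bsub>P\<^esub> p', q)) = f (frag_of (p, q)) + f (frag_of (p', q))"
    and "\<And>p q q'. p \<in> carrier P \<Longrightarrow> q \<in> carrier Q \<Longrightarrow> q' \<in> carrier Q \<Longrightarrow>
      f (frag_of (p, q \<oplus>\<^bsub>Q\<^esub> q')) = f (frag_of (p, q)) + f (frag_of (p, q'))"
    and "\<And>r p q. r \<in> carrier R \<Longrightarrow> p \<in> carrier P \<Longrightarrow> q \<in> carrier Q \<Longrightarrow>
      f (frag_of (r \<odot>\<^bsub>P\<^esub> p, q)) = f (frag_of (p, r \<odot>\<^bsub>Q\<^esub> q))"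
  shows "f (SOME y. y \<in> cl x) = f x"
proof -
  have "f 0 = 0"
    using diff[of 0 0] by simp
  have "f h = 0" if "h \<in> N" for h
    using that by (induction rule: subgroup_induct) (auto simp: assms \<open>f 0 = 0\<close>)
  moreover have "(SOME y. y \<in> cl x) \<in> cl x"
    using class_self[of x] by (rule someI)
  ultimately have "f ((SOME y. y \<in> cl x) - x) = 0"
    by (simp only: mem_class)
  then show ?thesis
    by (simp add: diff)
qed

end

text \<open>Supplies the balancing relation over the integers for coefficient maps known only to be
  additive. With the identity for \<open>f\<close> it also computes integer multiples in
  \<open>complex_ring\<close>.\<close>

lemma add_pow_additive:
  fixes f :: "'a \<Rightarrow> 'c::ring_1" and k :: int
  assumes "abelian_group A" "a \<in> carrier A"
    and add: "\<And>x y. x \<in> carrier A \<Longrightarrow> y \<in> carrier A \<Longrightarrow> f (x \<oplus>\<^bsub>A\<^esub> y) = f x + f y"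
  shows "f ([k] \<cdot>\<^bsub>A\<^esub> a) = of_int k * f a"
proof -
  interpret A: abelian_group A by fact
  have zero: "f \<zero>\<^bsub>A\<^esub> = 0"
    using add[of "\<zero>\<^bsub>A\<^esub>" "\<zero>\<^bsub>A\<^esub>"] by simp
  have neg: "f (\<ominus>\<^bsub>A\<^esub> x) = - f x" if "x \<in> carrier A" for x
    using add[of "\<ominus>\<^bsub>A\<^esub> x" x] that by (simp add: A.l_neg zero eq_neg_iff_add_eq_0)
  have nat: "f ([n] \<cdot>\<^bsub>A\<^esub> a) = of_nat n * f a" for n :: nat
    by (induction n) (simp_all add: zero add assms(2) algebra_simps)
  show ?thesis
  proof (cases "0 \<le> k")
    case True
    then show ?thesis
      using nat[of "nat k"] by (simp add: add_pow_int_ge)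
  next
    case False
    then show ?thesis
      using nat[of "nat (- k)"] assms(2) by (simp add: add_pow_int_lt neg)
  qed
qed

section \<open>Rings as integer algebras, and the complex numbers\<close>

lemma scalar_algebra_int_module:
  assumes "ring A"
  shows "scalar_algebra \<Z> (int_module A)"
proof -
  interpret ring A by fact
  have "abelian_group (int_module A)"
  proof (rule abelian_groupI)
    fix x assume "x \<in> carrier (int_module A)"
    then show "\<exists>y\<in>carrier (int_module A). y \<oplus>\<^bsub>int_module A\<^esub> x = \<zero>\<^bsub>int_module A\<^esub>"
      by (intro bexI[of _ "\<ominus>\<^bsub>A\<^esub> x"]) (auto simp: int_module_def l_neg)
  qed (auto simp: int_module_def a_ac)
  moreover have "[r] \<cdot>\<^bsub>A\<^esub> ([s] \<cdot>\<^bsub>A\<^esub> p) = [s] \<cdot>\<^bsub>A\<^esub> ([r] \<cdot>\<^bsub>A\<^esub> p)" if "p \<in> carrier A" for r s :: int and p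
    using that by (simp add: add.int_pow_pow mult.commute)
  ultimately show ?thesis
    unfolding scalar_algebra_def scalar_algebra_axioms_def
    by (auto simp: int_module_def l_distr r_distr add.int_pow_distrib add_pow_ldistr_int add_pow_rdistr_int)
qed

lemma ring_complex_ring: "ring complex_ring"
proof (rule ringI)
  show "abelian_group complex_ring"
  proof (rule abelian_groupI)
    fix x assume "x \<in> carrier complex_ring"
    show "\<exists>y\<in>carrier complex_ring. y \<oplus>\<^bsub>complex_ring\<^esub> x = \<zero>\<^bsub>complex_ring\<^esub>"
      by (rule bexI[of _ "- x"]) auto
  qed auto
  show "Group.monoid complex_ring"
    by (rule monoidI) auto
qed (auto simp: algebra_simps)

lemma complex_ring_add_pow: "[k] \<cdot>\<^bsub>complex_ring\<^esub> z = of_int k * z" for k :: int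
  using add_pow_additive[of complex_ring z "\<lambda>x. x" k] ring.is_abelian_group[OF ring_complex_ring] by simp

lemma tensor_complexification:
  assumes "ring A"
  shows "tensor \<Z> (int_module A) (int_module complex_ring)"
  unfolding tensor_def by (intro conjI scalar_algebra_int_module assms ring_complex_ring)

section \<open>Complexification\<close>

text \<open>The additive extension of \<open>h\<close> with values in a vector space;
  \<open>frag_extend\<close> does this only for values in a free abelian group.\<close>

definition frag_eval :: "('f::ring_1 \<Rightarrow> 'b \<Rightarrow> 'b) \<Rightarrow> ('i \<Rightarrow> 'b) \<Rightarrow> ('i \<Rightarrow>\<^sub>0 int) \<Rightarrow> 'b::ab_group_add" where
  "frag_eval s h x = (\<Sum>k\<in>Poly_Mapping.keys x. s (of_int (Poly_Mapping.lookup x k)) (h k))"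

context vector_space
begin

lemma frag_eval_superset:
  assumes "finite S" "Poly_Mapping.keys x \<subseteq> S"
  shows "frag_eval scale h x = (\<Sum>k\<in>S. scale (of_int (Poly_Mapping.lookup x k)) (h k))"
  unfolding frag_eval_def using assms by (intro sum.mono_neutral_left) (auto simp: in_keys_iff)

lemma frag_eval_of [simp]: "frag_eval scale h (frag_of a) = h a"
  by (simp add: frag_eval_def)

lemma frag_eval_diff: "frag_eval scale h (x - y) = frag_eval scale h x - frag_eval scale h y"
proof -
  let ?S = "Poly_Mapping.keys x \<union> Poly_Mapping.keys y"
  have "frag_eval scale h (x - y) = (\<Sum>k\<in>?S. scale (of_int (Poly_Mapping.lookup (x - y) k)) (h k))"
    by (intro frag_eval_superset keys_diff) simp
  also have "\<dots> = (\<Sum>k\<in>?S. scale (of_int (Poly_Mapping.lookup x k)) (h k)) -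
      (\<Sum>k\<in>?S. scale (of_int (Poly_Mapping.lookup y k)) (h k))"
    by (simp add: lookup_minus scale_left_diff_distrib sum_subtractf)
  also have "\<dots> = frag_eval scale h x - frag_eval scale h y"
    by (simp add: frag_eval_superset[of ?S])
  finally show ?thesis .
qed

lemma frag_eval_zero [simp]: "frag_eval scale h 0 = 0"
  using frag_eval_diff[of h 0 0] by simp

lemma frag_eval_add: "frag_eval scale h (x + y) = frag_eval scale h x + frag_eval scale h y"
  using frag_eval_diff[of h "x + y" y] by (simp add: algebra_simps)

lemma frag_eval_sum: "frag_eval scale h (sum f I) = (\<Sum>i\<in>I. frag_eval scale h (f i))"
  by (induction I rule: infinite_finite_induct) (simp_all add: frag_eval_add)

end

lemma vector_space_complex: "vector_space ((*) :: complex \<Rightarrow> complex \<Rightarrow> complex)"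
  by unfold_locales (simp_all add: algebra_simps)

lemmas complex_frag_eval_diff = vector_space.frag_eval_diff[OF vector_space_complex]
lemmas complex_frag_eval_add = vector_space.frag_eval_add[OF vector_space_complex]
lemmas complex_frag_eval_of = vector_space.frag_eval_of[OF vector_space_complex]
lemmas complex_frag_eval_zero = vector_space.frag_eval_zero[OF vector_space_complex]

locale complexified = ring A for A :: "('a, 'x) ring_scheme" (structure)
begin

sublocale CT: tensor \<Z> "int_module A" "int_module complex_ring"
  by (rule tensor_complexification[OF ring_axioms])

abbreviation "C \<equiv> complexification A"
abbreviation "ct \<equiv> complex_tensor A"

lemma int_module_simps:
  "carrier (int_module A) = carrier A" "x \<otimes>\<^bsub>int_module A\<^esub> y = x \<otimes> y"
  "x \<oplus>\<^bsub>int_module A\<^esub> y = x \<oplus> y" "\<zero>\<^bsub>int_module A\<^esub> = \<zero>" "k \<odot>\<^bsub>int_module A\<^esub> x = [k] \<cdot> x"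
  "carrier (int_module complex_ring) = UNIV" "z \<otimes>\<^bsub>int_module complex_ring\<^esub> w = z * w"
  "z \<oplus>\<^bsub>int_module complex_ring\<^esub> w = z + w" "\<zero>\<^bsub>int_module complex_ring\<^esub> = 0"
  "k \<odot>\<^bsub>int_module complex_ring\<^esub> z = of_int k * z"
  by (simp_all add: int_module_def complex_ring_add_pow)

lemma complexification_simps:
  "carrier C = carrier CT.T" "X \<otimes>\<^bsub>C\<^esub> Y = X \<otimes>\<^bsub>CT.T\<^esub> Y" "X \<oplus>\<^bsub>C\<^esub> Y = X \<oplus>\<^bsub>CT.T\<^esub> Y"
  "\<zero>\<^bsub>C\<^esub> = \<zero>\<^bsub>CT.T\<^esub>" "z \<odot>\<^bsub>C\<^esub> X = ct \<one> z \<otimes>\<^bsub>CT.T\<^esub> X"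
  by (simp_all add: complexification_def Let_def)

lemma complex_tensor_class: "ct a z = CT.cl (frag_of (a, z))"
  by (simp add: complex_tensor_def pure_tensor_def)

lemma complex_tensor_closed: "a \<in> carrier A \<Longrightarrow> ct a z \<in> carrier C"
  by (simp add: complexification_simps complex_tensor_class CT.class_closed int_module_simps)

lemma complex_tensor_mult:
  "a \<in> carrier A \<Longrightarrow> b \<in> carrier A \<Longrightarrow> ct a z \<otimes>\<^bsub>C\<^esub> ct b w = ct (a \<otimes> b) (z * w)"
  by (simp add: complexification_simps complex_tensor_class CT.tensor_mult int_module_simps)

lemma complex_tensor_add:
  "a \<in> carrier A \<Longrightarrow> b \<in> carrier A \<Longrightarrow> ct a z \<oplus>\<^bsub>C\<^esub> ct b z = ct (a \<oplus> b) z"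
  using CT.subgroup_uminus[OF CT.rel_add_left[of a b z]]
  by (auto simp: complexification_simps complex_tensor_class CT.tensor_add int_module_simps
      algebra_simps intro!: CT.class_eq)

lemma scalar_class:
  "Poly_Mapping.keys x \<subseteq> CT.pairs \<Longrightarrow>
    z \<odot>\<^bsub>C\<^esub> CT.cl x = CT.cl (frag_mult CT.pmult (frag_of (\<one>, z)) x)"
  by (simp add: complexification_simps complex_tensor_class CT.tensor_mult int_module_simps)

lemma scalar_algebra_complexification: "scalar_algebra complex_ring C"
proof -
  interpret T: abelian_group CT.T
    by (rule CT.abelian_group_tensor)
  have group: "abelian_group C"
  proof (rule abelian_groupI)
    fix X assume "X \<in> carrier C"
    then show "\<exists>Y\<in>carrier C. Y \<oplus>\<^bsub>C\<^esub> X = \<zero>\<^bsub>C\<^esub>"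
      by (intro bexI[of _ "\<ominus>\<^bsub>CT.T\<^esub> X"]) (auto simp: complexification_simps T.l_neg)
  qed (auto simp: complexification_simps T.a_ac)
  \<comment> \<open>Multiplication by 1 tensor z, which is how z acts. It passes through products on
    either side because 1 is the unit of \<open>A\<close> and complex multiplication commutes;
    \<open>A\<close> need not be commutative.\<close>
  let ?L = "\<lambda>z. frag_mult CT.pmult (frag_of (\<one>, z))"
  have keys: "Poly_Mapping.keys (?L z x) \<subseteq> CT.pairs" if "Poly_Mapping.keys x \<subseteq> CT.pairs" for z x
    using that by (intro CT.keys_pmult) (auto simp: int_module_simps)
  have comm: "?L r (?L s x) = ?L s (?L r x)" if "Poly_Mapping.keys x \<subseteq> CT.pairs" for r s x
    using that by (induction rule: frag_induction)
      (auto simp: int_module_simps frag_mult_diff_right mult.left_commute)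
  have left: "frag_mult CT.pmult (?L r x) y = ?L r (frag_mult CT.pmult x y)"
    and right: "frag_mult CT.pmult x (?L r y) = ?L r (frag_mult CT.pmult x y)"
    if "Poly_Mapping.keys x \<subseteq> CT.pairs" "Poly_Mapping.keys y \<subseteq> CT.pairs" for r x y
    using that by (induction rule: frag_mult_induct)
      (auto simp: int_module_simps frag_mult_diff_left frag_mult_diff_right mult.left_commute mult.assoc)
  show ?thesis
  proof (intro scalar_algebra.intro[OF group] scalar_algebra_axioms.intro)
    fix r s p assume "p \<in> carrier C"
    then obtain x where "Poly_Mapping.keys x \<subseteq> CT.pairs" "p = CT.cl x"
      by (auto simp: complexification_simps CT.tensor_carrier)
    then show "r \<odot>\<^bsub>C\<^esub> p \<in> carrier C" "r \<odot>\<^bsub>C\<^esub> (s \<odot>\<^bsub>C\<^esub> p) = s \<odot>\<^bsub>C\<^esub> (r \<odot>\<^bsub>C\<^esub> p)"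
      using keys by (simp_all add: scalar_class comm) (simp add: complexification_simps CT.class_closed)
  next
    fix r p q assume "p \<in> carrier C" "q \<in> carrier C"
    then obtain x y where xy: "Poly_Mapping.keys x \<subseteq> CT.pairs" "p = CT.cl x"
        "Poly_Mapping.keys y \<subseteq> CT.pairs" "q = CT.cl y"
      by (auto simp: complexification_simps CT.tensor_carrier)
    have mult: "CT.cl a \<otimes>\<^bsub>C\<^esub> CT.cl b = CT.cl (frag_mult CT.pmult a b)"
      if "Poly_Mapping.keys a \<subseteq> CT.pairs" "Poly_Mapping.keys b \<subseteq> CT.pairs" for a b
      using that by (simp add: complexification_simps CT.tensor_mult)
    show "r \<odot>\<^bsub>C\<^esub> p \<otimes>\<^bsub>C\<^esub> q = r \<odot>\<^bsub>C\<^esub> (p \<otimes>\<^bsub>C\<^esub> q)"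
      "p \<otimes>\<^bsub>C\<^esub> (r \<odot>\<^bsub>C\<^esub> q) = r \<odot>\<^bsub>C\<^esub> (p \<otimes>\<^bsub>C\<^esub> q)"
      using xy keys CT.keys_pmult[OF xy(1,3)] by (simp_all add: scalar_class mult left right)
  qed (auto simp: complexification_simps CT.tensor_mult_closed CT.tensor_l_distr CT.tensor_r_distr
      complex_tensor_closed[unfolded complexification_simps])
qed

text \<open>For additive \<open>f\<close> this is its complex-linear extension to the
  complexification, a tensor z going to f(a) z, read off an arbitrary representative.\<close>

definition complex_coeff :: "('a \<Rightarrow> int) \<Rightarrow> ('a \<times> complex \<Rightarrow>\<^sub>0 int) set \<Rightarrow> complex" where
  "complex_coeff f X = frag_eval (*) (\<lambda>(a, z). of_int (f a) * z) (SOME x. x \<in> X)"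

lemma complex_coeff_class:
  assumes f: "\<And>a b. a \<in> carrier A \<Longrightarrow> b \<in> carrier A \<Longrightarrow> f (a \<oplus> b) = f a + f b"
  shows "complex_coeff f (CT.cl x) = frag_eval (*) (\<lambda>(a, z). of_int (f a) * z) x"
  unfolding complex_coeff_def
proof (rule CT.additive_on_class)
  show "frag_eval (*) (\<lambda>(a, z). of_int (f a) * z) (frag_of (k \<odot>\<^bsub>int_module A\<^esub> p, q)) =
      frag_eval (*) (\<lambda>(a, z). of_int (f a) * z) (frag_of (p, k \<odot>\<^bsub>int_module complex_ring\<^esub> q))"
    if "p \<in> carrier (int_module A)" for k p q
    using add_pow_additive[OF abelian_group_axioms, of p f k] that f by (simp add: int_module_simps complex_frag_eval_of)
qed (auto simp: complex_frag_eval_diff complex_frag_eval_of complex_frag_eval_zero int_module_simps f algebra_simps)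

lemma complex_coeff_tensor:
  assumes "\<And>a b. a \<in> carrier A \<Longrightarrow> b \<in> carrier A \<Longrightarrow> f (a \<oplus> b) = f a + f b"
  shows "complex_coeff f (ct a z) = of_int (f a) * z"
  by (simp add: complex_tensor_class complex_coeff_class[OF assms] complex_frag_eval_of)

lemma complex_coeff_add:
  assumes "\<And>a b. a \<in> carrier A \<Longrightarrow> b \<in> carrier A \<Longrightarrow> f (a \<oplus> b) = f a + f b"
    and "X \<in> carrier C" "Y \<in> carrier C"
  shows "complex_coeff f (X \<oplus>\<^bsub>C\<^esub> Y) = complex_coeff f X + complex_coeff f Y"
  using assms(2,3)
  by (auto simp: complexification_simps CT.tensor_carrier CT.tensor_add complex_coeff_class[OF assms(1)]
      complex_frag_eval_add)

lemma complex_coeff_scalar: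
  assumes "\<And>a b. a \<in> carrier A \<Longrightarrow> b \<in> carrier A \<Longrightarrow> f (a \<oplus> b) = f a + f b"
    and "X \<in> carrier C"
  shows "complex_coeff f (z \<odot>\<^bsub>C\<^esub> X) = z * complex_coeff f X"
proof -
  obtain x where x: "Poly_Mapping.keys x \<subseteq> CT.pairs" "X = CT.cl x"
    using assms(2) by (auto simp: complexification_simps CT.tensor_carrier)
  let ?e = "frag_eval (*) (\<lambda>(a, z). of_int (f a) * z)"
  have "?e (frag_mult CT.pmult (frag_of (\<one>, z)) x) = z * ?e x"
    using x(1) by (induction rule: frag_induction)
      (auto simp: int_module_simps frag_mult_diff_right complex_frag_eval_diff complex_frag_eval_of complex_frag_eval_zero algebra_simps)
  then show ?thesis
    by (simp add: x scalar_class complex_coeff_class[OF assms(1)])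
qed

end

section \<open>Rank-2 flats\<close>

context matroid
begin

lemma finite_independent_subsets: "finite {I. I \<subseteq> S \<and> indep I}"
  by (rule finite_subset[of _ "Pow M"]) (auto simp: finite_ground dest: indep_ground)

lemma card_le_rank: "I \<subseteq> S \<Longrightarrow> indep I \<Longrightarrow> card I \<le> matroid_rank indep S"
  unfolding matroid_rank_def by (rule Max_ge) (auto simp: finite_independent_subsets)

lemma rank_attained: "\<exists>I \<subseteq> S. indep I \<and> card I = matroid_rank indep S"
proof -
  have "matroid_rank indep S \<in> card ` {I. I \<subseteq> S \<and> indep I}"
    unfolding matroid_rank_def
    by (rule Max_in) (use finite_independent_subsets indep_empty in auto)
  then show ?thesis by auto
qed

end

text \<open>For distinct \<open>u\<close> and \<open>v\<close> in a simple matroid, the rank-2 flat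
  that they span. The points \<open>u\<close> and \<open>v\<close> are listed separately because for
  them \<open>{u, v, w}\<close> is just an independent pair.\<close>

definition line :: "'m set \<Rightarrow> ('m set \<Rightarrow> bool) \<Rightarrow> 'm \<Rightarrow> 'm \<Rightarrow> 'm set" where
  "line M indep u v = {w \<in> M. w = u \<or> w = v \<or> \<not> indep {u, v, w}}"

locale simple = matroid +
  assumes simple: "simple_matroid M indep"
begin

lemma indep_pair: "u \<in> M \<Longrightarrow> v \<in> M \<Longrightarrow> indep {u, v}"
  using simple card_insert_le_m1[of 2 "{v}" u] by (simp add: simple_matroid_def)

text \<open>Both directions of the correspondence between lines and rank-2 flats rest on this: any
  independent set with three elements contains a point that is independent of the given
  pair.\<close>

lemma augment_pair:
  assumes "u \<in> M" "v \<in> M" "indep I" "3 \<le> card I"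
  shows "\<exists>w \<in> I - {u, v}. indep {u, v, w}"
proof -
  have "card {u, v} \<le> 2"
    using card_insert_le_m1[of 2 "{v}" u] by simp
  then have "\<exists>w \<in> I - {u, v}. indep (insert w {u, v})"
    using assms indep_pair by (intro indep_augment) auto
  then show ?thesis
    by (simp add: insert_commute)
qed

lemma line_rank2_flat:
  assumes "u \<in> M" "v \<in> M" "u \<noteq> v"
  shows "line M indep u v \<in> rank2_flats M indep"
proof -
  let ?L = "line M indep u v"
  \<comment> \<open>A larger independent subset would contain a point w outside
    \<open>{u, v}\<close> with \<open>{u, v, w}\<close> independent, which membership in the line
    excludes.\<close>
  have "card I \<le> 2" if "I \<subseteq> ?L" "indep I" for I
    using augment_pair[of u v I] that assms by (force simp: line_def)
  then have "matroid_rank indep ?L \<le> 2"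
    using rank_attained[of ?L] by metis
  moreover have "2 \<le> matroid_rank indep ?L"
    using card_le_rank[of "{u, v}" ?L] assms indep_pair by (auto simp: line_def)
  ultimately have rank: "matroid_rank indep ?L = 2"
    by simp
  have "matroid_rank indep ?L < matroid_rank indep (insert w ?L)" if w: "w \<in> M - ?L" for w
    using card_le_rank[of "{u, v, w}" "insert w ?L"] w assms rank by (auto simp: line_def)
  then show ?thesis
    using rank by (auto simp: rank2_flats_def flat_def line_def)
qed

lemma rank2_flat_dependent:
  assumes "X \<in> rank2_flats M indep" "I \<subseteq> X" "card I = 3"
  shows "\<not> indep I"
  using card_le_rank[of I X] assms by (auto simp: rank2_flats_def)

lemma rank2_flat_subset: "X \<in> rank2_flats M indep \<Longrightarrow> X \<subseteq> M"
  by (auto simp: rank2_flats_def flat_def)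

lemma rank2_flat_eq_line:
  assumes X: "X \<in> rank2_flats M indep" and uv: "u \<in> X" "v \<in> X" "u \<noteq> v"
  shows "X = line M indep u v"
proof
  have M: "u \<in> M" "v \<in> M"
    using rank2_flat_subset[OF X] uv by auto
  show "X \<subseteq> line M indep u v"
  proof
    fix w assume "w \<in> X"
    then show "w \<in> line M indep u v"
      using rank2_flat_dependent[OF X, of "{u, v, w}"] rank2_flat_subset[OF X] uv
      by (auto simp: line_def)
  qed
  show "line M indep u v \<subseteq> X"
  proof
    fix w assume w: "w \<in> line M indep u v"
    show "w \<in> X"
    \<comment> \<open>A point w outside the flat would raise the rank to three. Augmenting
      \<open>{u, v}\<close> from an independent triple then yields z, which is not w because w lies
      on the line. So \<open>{u, v, z}\<close> is an independent triple inside \<open>X\<close>,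
      against its rank two.\<close>
    proof (rule ccontr)
      assume "w \<notin> X"
      then have "2 < matroid_rank indep (insert w X)"
        using X w by (auto simp: rank2_flats_def flat_def line_def)
      then obtain I where I: "I \<subseteq> insert w X" "indep I" "3 \<le> card I"
        using rank_attained[of "insert w X"] by auto
      then obtain z where z: "z \<in> I - {u, v}" "indep {u, v, z}"
        using augment_pair[OF M] by blast
      then have "z \<noteq> w"
        using w by (auto simp: line_def)
      then have "{u, v, z} \<subseteq> X" "card {u, v, z} = 3"
        using z I uv by auto
      then show False
        using rank2_flat_dependent[OF X] z(2) by blast
    qed
  qed
qed

text \<open>Exactly one line passes through two distinct elements, so the off-diagonal pairs split
  over the lines. The diagonal is taken out of each \<open>X \<times> X\<close>, since an element
  may lie on several lines, and is counted once in front.\<close>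

lemma sum_pairs_by_lines:
  fixes g :: "'a \<times> 'a \<Rightarrow> 'c::ab_group_add"
  shows "sum g (M \<times> M) = (\<Sum>u\<in>M. g (u, u)) +
    (\<Sum>X\<in>case_prod (line M indep) ` {p \<in> M \<times> M. fst p \<noteq> snd p}. sum g (X \<times> X) - (\<Sum>u\<in>X. g (u, u)))"
proof -
  let ?off = "\<lambda>X. {p \<in> X \<times> X. fst p \<noteq> snd p}"
  have split: "sum g (X \<times> X) = (\<Sum>u\<in>X. g (u, u)) + sum g (?off X)" if "finite X" for X
  proof -
    have "sum g (X \<times> X) = sum g ((\<lambda>u. (u, u)) ` X \<union> ?off X)"
      by (rule arg_cong[where f="sum g"]) auto
    also have "\<dots> = sum g ((\<lambda>u. (u, u)) ` X) + sum g (?off X)"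
      using that by (intro sum.union_disjoint) auto
    also have "sum g ((\<lambda>u. (u, u)) ` X) = (\<Sum>u\<in>X. g (u, u))"
      by (simp add: sum.reindex inj_on_def)
    finally show ?thesis .
  qed
  have "sum g (?off M) =
      (\<Sum>X\<in>case_prod (line M indep) ` ?off M. sum g {p \<in> ?off M. case_prod (line M indep) p = X})"
    by (rule sum.image_gen) (simp add: finite_ground)
  also have "\<dots> = (\<Sum>X\<in>case_prod (line M indep) ` ?off M. sum g (X \<times> X) - (\<Sum>u\<in>X. g (u, u)))"
  proof (rule sum.cong[OF refl])
    fix X assume "X \<in> case_prod (line M indep) ` ?off M"
    then have X: "X \<in> rank2_flats M indep"
      using line_rank2_flat by auto
    have key: "line M indep u v = X \<longleftrightarrow> u \<in> X \<and> v \<in> X" if "u \<in> M" "v \<in> M" "u \<noteq> v" for u v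
    proof
      show "line M indep u v = X \<Longrightarrow> u \<in> X \<and> v \<in> X"
        using that by (auto simp: line_def)
      show "u \<in> X \<and> v \<in> X \<Longrightarrow> line M indep u v = X"
        using rank2_flat_eq_line[OF X _ _ that(3)] by metis
    qed
    have "p \<in> ?off M \<and> case_prod (line M indep) p = X \<longleftrightarrow> p \<in> X \<times> X \<and> fst p \<noteq> snd p" for p
      using key[of "fst p" "snd p"] rank2_flat_subset[OF X]
      by (simp add: case_prod_unfold mem_Times_iff) blast
    then have "{p \<in> ?off M. case_prod (line M indep) p = X} = ?off X"
      by (rule Collect_cong)
    then show "sum g {p \<in> ?off M. case_prod (line M indep) p = X} = sum g (X \<times> X) - (\<Sum>u\<in>X. g (u, u))"
      using split[of X] finite_subset[OF rank2_flat_subset[OF X] finite_ground] by simp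
  qed
  finally show ?thesis
    using split[OF finite_ground] by simp
qed

end

section \<open>Connections\<close>

context lie_algebra
begin

lemma bracket_zero_right [simp]: "bracket x 0 = 0"
  using bracket_add_right[of x 0 0] by simp

lemma bracket_antisym: "bracket x y = - bracket y x"
proof -
  have "bracket x y + bracket y x = bracket (x + y) (x + y)"
    unfolding bracket_add_left bracket_add_right by (simp add: bracket_self)
  also have "\<dots> = 0"
    by (rule bracket_self)
  finally show ?thesis
    by (rule eq_neg_iff_add_eq_0[THEN iffD2])
qed

lemma bracket_sum_right: "bracket x (sum f I) = (\<Sum>i\<in>I. bracket x (f i))"
  by (induction I rule: infinite_finite_induct) (simp_all add: bracket_add_right)

end

lemma scalar_algebra_lie_module:
  assumes "lie_algebra scale bracket"
  shows "scalar_algebra complex_ring (lie_module scale bracket)"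
proof -
  interpret lie_algebra scale bracket by fact
  have "abelian_group (lie_module scale bracket)"
  proof (rule abelian_groupI)
    fix x assume "x \<in> carrier (lie_module scale bracket)"
    show "\<exists>y\<in>carrier (lie_module scale bracket).
        y \<oplus>\<^bsub>lie_module scale bracket\<^esub> x = \<zero>\<^bsub>lie_module scale bracket\<^esub>"
      by (rule bexI[of _ "- x"]) (auto simp: lie_module_def)
  qed (auto simp: lie_module_def ac_simps)
  then show ?thesis
    unfolding scalar_algebra_def scalar_algebra_axioms_def
    by (auto simp: lie_module_def bracket_add_left bracket_add_right bracket_scale_left
        bracket_scale_right scale_right_distrib mult.commute)
qed

locale os_connections = simple M indep + lie: lie_algebra scale bracket
  for M :: "'m set" and indep and scale :: "complex \<Rightarrow> 'g::ab_group_add \<Rightarrow> 'g" and bracket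
begin

abbreviation "A \<equiv> orlik_solomon M indep"
abbreviation "V \<equiv> os_lie M indep scale bracket"
abbreviation "conn \<equiv> connection M indep scale bracket"

sublocale O: complexified A
  by (simp add: complexified_def ring_orlik_solomon)

sublocale L: tensor complex_ring O.C "lie_module scale bracket"
  by (simp add: tensor_def O.scalar_algebra_complexification scalar_algebra_lie_module lie.lie_algebra_axioms)

abbreviation "E u \<equiv> O.ct (os_gen M indep u) 1"
abbreviation "conn_frag c \<equiv> \<Sum>u\<in>M. frag_of (E u, c u)"

lemma lie_module_simps:
  "carrier (lie_module scale bracket) = UNIV" "x \<otimes>\<^bsub>lie_module scale bracket\<^esub> y = bracket x y"
  "x \<oplus>\<^bsub>lie_module scale bracket\<^esub> y = x + y" "\<zero>\<^bsub>lie_module scale bracket\<^esub> = 0"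
  "z \<odot>\<^bsub>lie_module scale bracket\<^esub> x = scale z x"
  by (simp_all add: lie_module_def)

lemma os_lie_eq: "V = L.T"
  by (simp add: os_lie_def)

lemma os_lie_tensor_class: "os_lie_tensor M indep scale bracket a z x = L.cl (frag_of (O.ct a z, x))"
  by (simp add: os_lie_tensor_def pure_tensor_def)

lemma E_closed: "u \<in> M \<Longrightarrow> E u \<in> carrier O.C"
  by (simp add: O.complex_tensor_closed os_gen_closed)

lemma E_keys: "u \<in> M \<Longrightarrow> Poly_Mapping.keys (frag_of (E u, x)) \<subseteq> L.pairs"
  by (simp add: E_closed lie_module_simps)

text \<open>Makes \<open>conn_frag c\<close> an explicit representative, so that statements about
  connections become statements about \<open>L.N\<close>.\<close>

lemma connection_class: "conn c = L.cl (conn_frag c)"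
  unfolding connection_def os_lie_tensor_class os_lie_eq
  using finite_ground E_keys by (rule L.finsum_class)

lemma conn_frag_keys: "Poly_Mapping.keys (conn_frag c) \<subseteq> L.pairs"
  using E_keys by (intro order_trans[OF keys_sum] UN_least)

lemma connection_degree_one: "conn c \<in> os_lie_degree_one M indep scale bracket"
proof -
  have "L.cl (\<Sum>u\<in>U. frag_of (E u, c u)) \<in> os_lie_degree_one M indep scale bracket"
    if "finite U" "U \<subseteq> M" for U
    using that
  proof (induction rule: finite_induct)
    case empty
    have "\<zero>\<^bsub>V\<^esub> \<in> os_lie_degree_one M indep scale bracket"
      using generate.one[of "add_monoid V"] by (simp add: os_lie_degree_one_def)
    then show ?case
      by (simp add: os_lie_eq L.tensor_zero)
  next
    case (insert u U)
    then have "os_gen M indep u \<in> os_degree_one M indep"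
      by (auto simp: os_degree_one_def intro!: imageI frag_of_degree_one)
    then have "L.cl (frag_of (E u, c u)) \<in> os_lie_degree_one M indep scale bracket"
      unfolding os_lie_degree_one_def os_lie_tensor_class[symmetric]
      by (intro generate.incl) blast
    then have "L.cl (frag_of (E u, c u)) \<oplus>\<^bsub>V\<^esub> L.cl (\<Sum>u\<in>U. frag_of (E u, c u)) \<in> os_lie_degree_one M indep scale bracket"
      using insert generate.eng[of _ "add_monoid V"] unfolding os_lie_degree_one_def by simp
    then show ?case
      using insert.hyps by (simp add: os_lie_eq L.tensor_add)
  qed
  then show ?thesis
    by (simp add: connection_class finite_ground)
qed

lemma connection_add: "conn (\<lambda>u. c u + d u) = conn c \<oplus>\<^bsub>V\<^esub> conn d"
proof -
  have "(\<Sum>u\<in>M. frag_of (E u, c u + d u) - frag_of (E u, c u) - frag_of (E u, d u)) \<in> L.N"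
    using L.rel_add_right[unfolded lie_module_simps] E_closed by (intro L.subgroup_sum) auto
  then show ?thesis
    unfolding connection_class os_lie_eq L.tensor_add
    by (intro L.class_eq) (simp add: sum_subtractf sum.distrib diff_diff_add)
qed

lemma connection_scale: "conn (\<lambda>u. scale z (c u)) = z \<odot>\<^bsub>V\<^esub> conn c"
proof -
  have "L.scale_left z (conn_frag c) = (\<Sum>u\<in>M. frag_of (z \<odot>\<^bsub>O.C\<^esub> E u, c u))"
    by (simp add: frag_extend_sum finite_ground)
  \<comment> \<open>The balancing relations move the scalar from \<open>E u\<close> onto
    \<open>c u\<close>.\<close>
  moreover have "(\<Sum>u\<in>M. frag_of (z \<odot>\<^bsub>O.C\<^esub> E u, c u) - frag_of (E u, scale z (c u))) \<in> L.N"
    using L.rel_scalar[unfolded lie_module_simps] E_closed by (intro L.subgroup_sum) auto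
  ultimately have "L.cl (L.scale_left z (conn_frag c)) = conn (\<lambda>u. scale z (c u))"
    unfolding connection_class by (intro L.class_eq) (simp add: sum_subtractf)
  then show ?thesis
    unfolding connection_class os_lie_eq by (subst L.tensor_scalar) auto
qed

lemma connection_cong: "(\<And>u. u \<in> M \<Longrightarrow> c u = d u) \<Longrightarrow> conn c = conn d"
  by (simp add: connection_class cong: sum.cong)

text \<open>The coefficient of e_v as a map on the whole tensor product: Y tensor x goes to the
  v-coefficient of Y times x. It depends only on the class, so a connection determines its family on
  \<open>M\<close>; injectivity comes from here.\<close>

lemma connection_coefficient:
  assumes v: "v \<in> M"
  shows "frag_eval scale (\<lambda>(Y, x). scale (O.complex_coeff (os_coeff v) Y) x) (SOME y. y \<in> conn c) = c v"
proof -
  note add = os_coeff_add[OF simple, of _ _ v]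
  let ?h = "\<lambda>(Y, x). scale (O.complex_coeff (os_coeff v) Y) x"
  have "frag_eval scale ?h (SOME y. y \<in> conn c) = frag_eval scale ?h (conn_frag c)"
    unfolding connection_class
    by (rule L.additive_on_class)
      (auto simp: lie.frag_eval_diff lie_module_simps O.complex_coeff_add[OF add]
        O.complex_coeff_scalar[OF add] lie.scale_left_distrib lie.scale_right_distrib mult.commute)
  also have "\<dots> = (\<Sum>u\<in>M. scale (of_int (os_coeff v (os_gen M indep u))) (c u))"
    by (simp add: lie.frag_eval_sum O.complex_coeff_tensor[OF add])
  also have "\<dots> = (\<Sum>u\<in>M. if u = v then c u else 0)"
    by (intro sum.cong) (auto simp: os_coeff_os_class[OF simple])
  finally show ?thesis
    using v by (simp add: finite_ground)
qed

lemma connection_eqD: "conn c = conn d \<Longrightarrow> u \<in> M \<Longrightarrow> c u = d u"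
  using connection_coefficient[of u c] connection_coefficient[of u d] by simp

section \<open>The square of a connection and flatness\<close>

abbreviation "curv c u v \<equiv> frag_of (E u \<otimes>\<^bsub>O.C\<^esub> E v, bracket (c u) (c v))"

lemma E_mult: "u \<in> M \<Longrightarrow> v \<in> M \<Longrightarrow> E u \<otimes>\<^bsub>O.C\<^esub> E v = O.ct (os_gen M indep u \<otimes>\<^bsub>A\<^esub> os_gen M indep v) 1"
  by (simp add: O.complex_tensor_mult os_gen_closed)

lemma E_mult_closed: "u \<in> M \<Longrightarrow> v \<in> M \<Longrightarrow> E u \<otimes>\<^bsub>O.C\<^esub> E v \<in> carrier O.C"
  by (simp add: E_mult O.complex_tensor_closed os_gen_closed O.m_closed)

lemma E_relation:
  assumes X: "X \<in> rank2_flats M indep" and uvw: "u \<in> X" "v \<in> X" "w \<in> X"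
  shows "E u \<otimes>\<^bsub>O.C\<^esub> E v \<oplus>\<^bsub>O.C\<^esub> E v \<otimes>\<^bsub>O.C\<^esub> E w = E u \<otimes>\<^bsub>O.C\<^esub> E w"
proof -
  have M: "u \<in> M" "v \<in> M" "w \<in> M"
    using rank2_flat_subset[OF X] uvw by auto
  have "\<not> indep {u, v, w}" if "card {u, v, w} = 3"
    using rank2_flat_dependent[OF X] that uvw by simp
  from os_gen_relation[OF simple M this] show ?thesis
    using M by (simp add: E_mult O.complex_tensor_add os_gen_closed O.m_closed)
qed

text \<open>Additivity in the second factor merges the terms into p tensor 0, which is a
  relation.\<close>

lemma sum_tensor_zero:
  assumes p: "p \<in> carrier O.C" and "(\<Sum>i\<in>I. q i) = 0"
  shows "(\<Sum>i\<in>I. frag_of (p, q i)) \<in> L.N"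
proof -
  have zero: "frag_of (p, 0) \<in> L.N"
    using L.rel_zero_right[OF p] by (simp add: lie_module_simps)
  have "frag_of (p, \<Sum>i\<in>I. q i) - (\<Sum>i\<in>I. frag_of (p, q i)) \<in> L.N"
  proof (induction I rule: infinite_finite_induct)
    case (insert i I)
    have "frag_of (p, q i + sum q I) - frag_of (p, q i) - frag_of (p, sum q I) \<in> L.N"
      using L.rel_add_right[OF p, unfolded lie_module_simps] by simp
    from L.subgroup_add[OF this insert.IH] show ?case
      using insert.hyps by (simp add: algebra_simps)
  qed (use zero in auto)
  then show ?thesis
    using L.subgroup_diff[OF zero] assms(2) by fastforce
qed

lemma connection_square: "conn c \<otimes>\<^bsub>V\<^esub> conn c = L.cl (\<Sum>(u, v)\<in>M \<times> M. curv c u v)"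
proof -
  have "frag_mult L.pmult (conn_frag c) (conn_frag c) = (\<Sum>(u, v)\<in>M \<times> M. curv c u v)"
    by (subst frag_mult_sum_left[OF finite_ground])
      (simp add: frag_mult_sum_right finite_ground sum.cartesian_product lie_module_simps)
  then show ?thesis
    unfolding connection_class os_lie_eq
    by (simp only: L.tensor_mult[OF conn_frag_keys conn_frag_keys])
qed

lemma connection_flat:
  assumes flat: "\<And>X u. X \<in> rank2_flats M indep \<Longrightarrow> u \<in> X \<Longrightarrow> (\<Sum>v\<in>X. bracket (c u) (c v)) = 0"
  shows "conn c \<in> flat_connections M indep scale bracket"
proof -
  have diag: "curv c u u \<in> L.N" if "u \<in> M" for u
    using L.rel_zero_right[OF E_mult_closed[OF that that]] by (simp add: lie.bracket_self lie_module_simps)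
  have flat_sum: "(\<Sum>(u, v)\<in>X \<times> X. curv c u v) \<in> L.N" if X: "X \<in> rank2_flats M indep" for X
  proof (cases "X = {}")
    case False
    then obtain w where w: "w \<in> X" by blast
    note XM = rank2_flat_subset[OF X, THEN subsetD]
    let ?left = "\<lambda>u v. frag_of (E u \<otimes>\<^bsub>O.C\<^esub> E w, bracket (c u) (c v))"
    let ?right = "\<lambda>u v. frag_of (E v \<otimes>\<^bsub>O.C\<^esub> E w, bracket (c u) (c v))"
    \<comment> \<open>Modulo \<open>L.N\<close>, e_u e_v = e_u e_w - e_v e_w turns
      \<open>curv c u v\<close> into \<open>?left u v - ?right u v\<close>. The first tensor factor
      of \<open>?left\<close> does not depend on \<open>v\<close> and that of \<open>?right\<close>
      does not depend on \<open>u\<close>, so in each case one summation acts on the brackets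
      alone.\<close>
    have "?left u v - curv c u v - ?right u v \<in> L.N" if "u \<in> X" "v \<in> X" for u v
      using L.rel_add_left[of "E u \<otimes>\<^bsub>O.C\<^esub> E v" "E v \<otimes>\<^bsub>O.C\<^esub> E w" "bracket (c u) (c v)"] that w
      by (simp add: E_relation[OF X] E_mult_closed XM lie_module_simps)
    then have 1: "(\<Sum>u\<in>X. \<Sum>v\<in>X. ?left u v - curv c u v - ?right u v) \<in> L.N"
      by (intro L.subgroup_sum)
    have 2: "(\<Sum>u\<in>X. \<Sum>v\<in>X. ?left u v) \<in> L.N"
      using w by (intro L.subgroup_sum sum_tensor_zero E_mult_closed XM flat[OF X])
    \<comment> \<open>The hypothesis sums over the second argument of the bracket; antisymmetry
      supplies the sum over the first.\<close>
    have "(\<Sum>u\<in>X. bracket (c u) (c v)) = 0" if "v \<in> X" for v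
      using flat[OF X that] by (subst lie.bracket_antisym) (simp add: sum_negf)
    then have "(\<Sum>v\<in>X. \<Sum>u\<in>X. ?right u v) \<in> L.N"
      using w by (intro L.subgroup_sum sum_tensor_zero E_mult_closed XM)
    then have 3: "(\<Sum>u\<in>X. \<Sum>v\<in>X. ?right u v) \<in> L.N"
      by (subst sum.swap)
    have "(\<Sum>u\<in>X. \<Sum>v\<in>X. curv c u v) \<in> L.N"
      using L.subgroup_diff[OF L.subgroup_diff[OF 2 3] 1] by (simp add: sum_subtractf sum.distrib)
    then show ?thesis
      by (simp add: sum.cartesian_product)
  qed (simp add: L.subgroup_zero)
  \<comment> \<open>The unreduced \<open>case (u, u)\<close> is the form in which the diagonal
    appears when \<open>sum_pairs_by_lines\<close> is applied to a function given by matching on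
    pairs.\<close>
  have diag_sum: "(\<Sum>u\<in>X. case (u, u) of (u, v) \<Rightarrow> curv c u v) \<in> L.N" if "X \<subseteq> M" for X
    using diag that by (intro L.subgroup_sum) auto
  have "(\<Sum>(u, v)\<in>M \<times> M. curv c u v) \<in> L.N"
    unfolding sum_pairs_by_lines
  proof (rule L.subgroup_add[OF diag_sum[OF subset_refl] L.subgroup_sum])
    fix X assume "X \<in> case_prod (line M indep) ` {p \<in> M \<times> M. fst p \<noteq> snd p}"
    then have X: "X \<in> rank2_flats M indep"
      using line_rank2_flat by auto
    show "(\<Sum>(u, v)\<in>X \<times> X. curv c u v) - (\<Sum>u\<in>X. case (u, u) of (u, v) \<Rightarrow> curv c u v) \<in> L.N"
      by (rule L.subgroup_diff[OF flat_sum[OF X] diag_sum[OF rank2_flat_subset[OF X]]])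
  qed
  then have "conn c \<otimes>\<^bsub>V\<^esub> conn c = \<zero>\<^bsub>V\<^esub>"
    unfolding connection_square unfolding os_lie_eq by (rule L.class_zero)
  then show ?thesis
    by (simp add: flat_connections_def connection_degree_one)
qed

end

section \<open>Evaluation along a non-constant special function\<close>

lemma (in simple) special_fun_image:
  assumes "\<tau> \<in> special_funs M indep K - const_funs M K" "K \<noteq> {}"
  shows "\<tau> ` M = K"
proof -
  have \<tau>: "\<tau> \<in> M \<rightarrow>\<^sub>E K"
    using assms(1) by (simp add: special_funs_def)
  have "\<exists>u\<in>M. \<exists>v\<in>M. \<tau> u \<noteq> \<tau> v"
  proof (rule ccontr)
    assume "\<not> ?thesis"
    then have const: "\<And>u v. u \<in> M \<Longrightarrow> v \<in> M \<Longrightarrow> \<tau> u = \<tau> v" by blast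
    have "\<exists>k\<in>K. \<forall>u\<in>M. \<tau> u = k"
    \<comment> \<open>For empty \<open>M\<close> the constant has to be taken from \<open>K\<close>,
      which is where \<open>K\<close> being nonempty enters.\<close>
    proof (cases "M = {}")
      case False
      then obtain u where u: "u \<in> M" by blast
      then have "\<tau> u \<in> K"
        using \<tau> by (rule PiE_mem[rotated])
      then show ?thesis
        using const[OF _ u] by blast
    qed (use assms(2) in auto)
    then show False
      using assms(1) \<tau> by (simp add: const_funs_def)
  qed
  then obtain u v where uv: "u \<in> M" "v \<in> M" "\<tau> u \<noteq> \<tau> v" by blast
  let ?X = "line M indep u v"
  have "?X \<in> rank2_flats M indep" "u \<in> ?X" "v \<in> ?X"
    using uv line_rank2_flat[of u v] by (auto simp: line_def)
  then have "bij_betw \<tau> ?X K"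
    using assms(1) uv(3) unfolding special_funs_def by fastforce
  then have "K = \<tau> ` ?X"
    by (simp add: bij_betw_def)
  then show ?thesis
    using \<tau> by (auto simp: line_def)
qed

theorem proposition5p3:
  fixes M :: "'m set" and indep :: "'m set \<Rightarrow> bool"
    and scale :: "complex \<Rightarrow> 'g::ab_group_add \<Rightarrow> 'g" and bracket :: "'g \<Rightarrow> 'g \<Rightarrow> 'g"
    and K :: "'k set" and \<tau> :: "'m \<Rightarrow> 'k"
  assumes "simple_matroid M indep"
    and "lie_algebra scale bracket"
    and "\<exists>B. finite_dimensional_vector_space scale B"
    and "finite K" and "card K \<ge> 3"
    and "\<tau> \<in> special_funs M indep K - const_funs M K"
  shows
    "let V = os_lie M indep scale bracket;
         ev = (\<lambda>x. connection M indep scale bracket (eval_map M \<tau> x))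
     in ev ` sum_zero K \<subseteq> flat_connections M indep scale bracket \<and>
        (\<forall>x \<in> sum_zero K. \<forall>y \<in> sum_zero K.
           ev (\<lambda>\<alpha>\<in>K. x \<alpha> + y \<alpha>) = ev x \<oplus>\<^bsub>V\<^esub> ev y) \<and>
        (\<forall>z. \<forall>x \<in> sum_zero K. ev (\<lambda>\<alpha>\<in>K. scale z (x \<alpha>)) = z \<odot>\<^bsub>V\<^esub> ev x) \<and>
        inj_on ev (sum_zero K) \<and>
        (\<forall>x \<in> sum_zero K.
           family_rank scale M (eval_map M \<tau> x) = family_rank scale K x) \<and>
        (\<forall>x \<in> sum_zero K. x \<in> regular_sum_zero scale K \<longleftrightarrow>
           ev x \<in> regular_flat_connections M indep scale bracket)"
proof -
  interpret os_connections M indep scale bracket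
    using assms(1,2) by (simp add: os_connections_def simple_def simple_axioms_def simple_matroid_def)
  define ev where "ev = (\<lambda>x :: 'k \<Rightarrow> 'g. conn (eval_map M \<tau> x))"
  have image: "\<tau> ` M = K"
    using special_fun_image[OF assms(6)] assms(5) by fastforce
  have \<tau>: "\<tau> u \<in> K" if "u \<in> M" for u
    using image that by blast
  have flat: "ev x \<in> flat_connections M indep scale bracket" if x: "x \<in> sum_zero K" for x
    unfolding ev_def
  proof (rule connection_flat)
    fix X u assume X: "X \<in> rank2_flats M indep" and u: "u \<in> X"
    note XM = rank2_flat_subset[OF X, THEN subsetD]
    have "(\<Sum>v\<in>X. bracket (eval_map M \<tau> x u) (eval_map M \<tau> x v)) = (\<Sum>v\<in>X. bracket (x (\<tau> u)) (x (\<tau> v)))"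
      using u XM by (intro sum.cong) (auto simp: eval_map_def)
    also have "\<dots> = 0"
    proof -
      consider k where "\<forall>u\<in>X. \<tau> u = k" | "bij_betw \<tau> X K"
        using assms(6) X unfolding special_funs_def by blast
      then show ?thesis
      proof cases
        case 1
        then show ?thesis
          using u by (simp add: lie.bracket_self)
      next
        case 2
        then have "(\<Sum>v\<in>X. bracket (x (\<tau> u)) (x (\<tau> v))) = (\<Sum>\<alpha>\<in>K. bracket (x (\<tau> u)) (x \<alpha>))"
          by (rule sum.reindex_bij_betw)
        also have "\<dots> = bracket (x (\<tau> u)) (\<Sum>\<alpha>\<in>K. x \<alpha>)"
          by (simp add: lie.bracket_sum_right)
        finally show ?thesis
          using x by (simp add: sum_zero_def)
      qed
    qed
    finally show "(\<Sum>v\<in>X. bracket (eval_map M \<tau> x u) (eval_map M \<tau> x v)) = 0" .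
  qed
  have add: "ev (\<lambda>\<alpha>\<in>K. x \<alpha> + y \<alpha>) = ev x \<oplus>\<^bsub>V\<^esub> ev y" for x y
    unfolding ev_def connection_add[symmetric] by (rule connection_cong) (simp add: eval_map_def \<tau>)
  have scalar: "ev (\<lambda>\<alpha>\<in>K. scale z (x \<alpha>)) = z \<odot>\<^bsub>V\<^esub> ev x" for z x
    unfolding ev_def connection_scale[symmetric] by (rule connection_cong) (simp add: eval_map_def \<tau>)
  have inj: "inj_on ev (sum_zero K)"
  proof (rule inj_onI)
    fix x y assume xy: "x \<in> sum_zero K" "y \<in> sum_zero K" and eq: "ev x = ev y"
    have "x (\<tau> u) = y (\<tau> u)" if "u \<in> M" for u
      using connection_eqD[OF eq[unfolded ev_def] that] that by (simp add: eval_map_def)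
    \<comment> \<open>As \<open>\<tau>\<close> is onto \<open>K\<close>, agreement at every
      \<open>\<tau> u\<close> is agreement on \<open>K\<close>; outside \<open>K\<close> both
      families are undefined in the extensional sense.\<close>
    then show "x = y"
      using xy image unfolding sum_zero_def by (intro PiE_ext[of x K "\<lambda>_. UNIV" y]) auto
  qed
  \<comment> \<open>The rank depends only on the set of components, and both families have the same
    one because \<open>\<tau>\<close> maps \<open>M\<close> onto \<open>K\<close>.\<close>
  have rank: "family_rank scale M (eval_map M \<tau> x) = family_rank scale K x" for x
    unfolding family_rank_def image[symmetric] by (simp add: eval_map_def image_image cong: image_cong)
  have regular: "x \<in> regular_sum_zero scale K \<longleftrightarrow> ev x \<in> regular_flat_connections M indep scale bracket"
    if x: "x \<in> sum_zero K" for x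
  proof -
    \<comment> \<open>Regularity of a connection is stated through some family that induces it.
      Among extensional families on \<open>M\<close> there is only one, so the rank can be read off
      \<open>eval_map M \<tau> x\<close>.\<close>
    have "(\<exists>c \<in> M \<rightarrow>\<^sub>E UNIV. ev x = conn c \<and> 2 \<le> family_rank scale M c) \<longleftrightarrow>
        2 \<le> family_rank scale M (eval_map M \<tau> x)"
    proof
      assume "\<exists>c \<in> M \<rightarrow>\<^sub>E UNIV. ev x = conn c \<and> 2 \<le> family_rank scale M c"
      then obtain c where c: "c \<in> M \<rightarrow>\<^sub>E UNIV" "ev x = conn c" "2 \<le> family_rank scale M c" by blast
      have "c = eval_map M \<tau> x"
        using c(1) connection_eqD[OF c(2)[unfolded ev_def]]
        by (intro PiE_ext[of c M "\<lambda>_. UNIV"]) (auto simp: eval_map_def)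
      then show "2 \<le> family_rank scale M (eval_map M \<tau> x)"
        using c(3) by simp
    qed (auto simp: ev_def eval_map_def)
    then show ?thesis
      using x flat[OF x] by (simp add: regular_sum_zero_def regular_flat_connections_def rank)
  qed
  show ?thesis
    unfolding Let_def ev_def[symmetric]
    using flat add scalar inj rank regular by auto
qed

end
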